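(* Let $\varepsilon\in\mathbb R$, $n\ge1$, $M=\mathbb R^n$ and let $x^1,\dots,x^n,p_1,\dots,p_n$ be the standard coordinates on $T^*M=\mathbb R^n\oplus(\mathbb R^n)^*$. The brackets $$\{x^j,x^k\}=\varepsilon x^jx^k,\qquad \{p_j,p_k\}=-\varepsilon p_jp_k\qquad (j<k),$$ $$\{x^j,p_k\}=-\delta^j_k+\varepsilon\Big[x^jp_k+\delta^j_k\sum_{i}\big(1-\mathrm{sgn}(i-j)\big)x^ip_i\Big]$$ define a Poisson structure on $T^*M$. The projection $T^*M\to M$, $(x,p)\mapsto x$, is a Poisson map onto $M$ equipped with the Poisson structure $r_M$ given by $\{x^j,x^k\}=\varepsilon x^jx^k$ for $j<k$; the Poisson structure on $T^*M$ is non-degenerate in a neighbourhood of $(\mathbb R^n\oplus\{0\})\cup(\{0\}\oplus(\mathbb R^n)^* )$; and the zero section $\{p=0\}$ is a Lagrangian submanifold of the open symplectic subset where the structure is non-degenerate. (Here $r_M$ is the fundamental bi-vector field of the standard $r$-matrix $r=\varepsilon\sum_{j<k}e_j{}^k\wedge e_k{}^j$ of $sl(n,\mathbb R)$.)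
   Context: $\mathrm{sgn}(0)=0$, $\mathrm{sgn}(m)=\pm1$ for $\pm m>0$. $e_j{}^k$ are the matrix units, $e_j{}^k x=x^ke_j$. For $r=\sum_iX_i\wedge Y_i$, $X_i,Y_i$ acting linearly on $M$, the fundamental bi-vector field is $r_M(x)=\sum_i(X_ix)\wedge(Y_ix)$. *)

theory Defs
  imports "HOL-Analysis.Analysis"
begin

section \<open>Smooth maps on open sets\<close>

text \<open>Only meant for open \<open>U\<close>, where \<open>C_diff_on k U f\<close> says that \<open>f\<close> is \<open>C\<^sup>k\<close> on \<open>U\<close>.\<close>

primrec C_diff_on ::
    "nat \<Rightarrow> 'a::real_normed_vector set \<Rightarrow> ('a \<Rightarrow> 'b::real_normed_vector) \<Rightarrow> bool" where
  "C_diff_on 0 U f = continuous_on U f"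
| "C_diff_on (Suc k) U f =
     ((\<forall>x\<in>U. f differentiable (at x)) \<and>
      (\<forall>v. C_diff_on k U (\<lambda>x. frechet_derivative f (at x) v)))"

definition smooth_on :: "'a::real_normed_vector set \<Rightarrow> ('a \<Rightarrow> 'b::real_normed_vector) \<Rightarrow> bool" where
  "smooth_on U f \<longleftrightarrow> (\<forall>k. C_diff_on k U f)"

section \<open>Poisson structures on a Euclidean space\<close>

text \<open>A bi-vector at a point of \<open>'a\<close> is an alternating bilinear form on the dual space
  \<open>'a \<Rightarrow>\<^sub>L real\<close>.\<close>

type_synonym 'a bivec = "('a \<Rightarrow>\<^sub>L real) \<Rightarrow> ('a \<Rightarrow>\<^sub>L real) \<Rightarrow> real"

definition differential :: "('a::euclidean_space \<Rightarrow> real) \<Rightarrow> 'a \<Rightarrow> 'a \<Rightarrow>\<^sub>L real" where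
  "differential f x = Blinfun (frechet_derivative f (at x))"

definition bivector_field :: "('a::euclidean_space \<Rightarrow> 'a bivec) \<Rightarrow> bool" where
  "bivector_field \<pi> \<longleftrightarrow>
     (\<forall>x. bounded_bilinear (\<pi> x)) \<and>
     (\<forall>x \<alpha>. \<pi> x \<alpha> \<alpha> = 0) \<and>
     (\<forall>\<alpha> \<beta>. smooth_on UNIV (\<lambda>x. \<pi> x \<alpha> \<beta>))"

definition bracket ::
    "('a::euclidean_space \<Rightarrow> 'a bivec) \<Rightarrow> ('a \<Rightarrow> real) \<Rightarrow> ('a \<Rightarrow> real) \<Rightarrow> 'a \<Rightarrow> real" where
  "bracket \<pi> f g x = \<pi> x (differential f x) (differential g x)"

text \<open>For a smooth bi-vector field, bilinearity, skew-symmetry and the Leibniz rule for the bracket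
  of smooth functions are automatic, so only the Jacobi identity is required.\<close>

definition poisson_structure :: "('a::euclidean_space \<Rightarrow> 'a bivec) \<Rightarrow> bool" where
  "poisson_structure \<pi> \<longleftrightarrow>
     bivector_field \<pi> \<and>
     (\<forall>f g h. smooth_on UNIV f \<and> smooth_on UNIV g \<and> smooth_on UNIV h \<longrightarrow>
        (\<forall>x. bracket \<pi> f (bracket \<pi> g h) x + bracket \<pi> g (bracket \<pi> h f) x
              + bracket \<pi> h (bracket \<pi> f g) x = 0))"

definition poisson_map ::
    "('a::euclidean_space \<Rightarrow> 'a bivec) \<Rightarrow> ('b::euclidean_space \<Rightarrow> 'b bivec) \<Rightarrow> ('a \<Rightarrow> 'b) \<Rightarrow> bool" where
  "poisson_map \<pi> \<pi>' \<phi> \<longleftrightarrow>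
     smooth_on UNIV \<phi> \<and>
     (\<forall>f g. smooth_on UNIV f \<and> smooth_on UNIV g \<longrightarrow>
        bracket \<pi> (f \<circ> \<phi>) (g \<circ> \<phi>) = bracket \<pi>' f g \<circ> \<phi>)"

section \<open>Non-degeneracy, symplectic form, Lagrangian submanifolds\<close>

definition nondegenerate :: "('a::euclidean_space) bivec \<Rightarrow> bool" where
  "nondegenerate P \<longleftrightarrow> (\<forall>\<alpha>. (\<forall>\<beta>. P \<alpha> \<beta> = 0) \<longrightarrow> \<alpha> = 0)"

definition nondegeneracy_locus :: "('a::euclidean_space \<Rightarrow> 'a bivec) \<Rightarrow> 'a set" where
  "nondegeneracy_locus \<pi> = {x. nondegenerate (\<pi> x)}"

text \<open>\<open>flat P\<close> is the inverse of the map \<open>\<alpha> \<mapsto> P \<alpha> \<cdot>\<close> from the dual of \<open>'a\<close> to its bidual \<open>'a\<close>.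
  It is meaningful, like \<open>symplectic_form\<close>, only where \<open>P\<close> is non-degenerate.\<close>

definition flat :: "('a::euclidean_space) bivec \<Rightarrow> 'a \<Rightarrow> 'a \<Rightarrow>\<^sub>L real" where
  "flat P u = (THE \<alpha>. \<forall>\<beta>. blinfun_apply \<beta> u = P \<alpha> \<beta>)"

definition symplectic_form ::
    "('a::euclidean_space \<Rightarrow> 'a bivec) \<Rightarrow> 'a \<Rightarrow> 'a \<Rightarrow> 'a \<Rightarrow> real" where
  "symplectic_form \<pi> x u v = \<pi> x (flat (\<pi> x) u) (flat (\<pi> x) v)"

text \<open>The last clause is \<open>d\<omega> = 0\<close>, evaluated on constant vector fields.\<close>

definition symplectic_on :: "'a::euclidean_space set \<Rightarrow> ('a \<Rightarrow> 'a \<Rightarrow> 'a \<Rightarrow> real) \<Rightarrow> bool" where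
  "symplectic_on U \<omega> \<longleftrightarrow>
     open U \<and>
     (\<forall>x\<in>U. bounded_bilinear (\<omega> x)) \<and>
     (\<forall>x\<in>U. \<forall>u. \<omega> x u u = 0) \<and>
     (\<forall>x\<in>U. \<forall>u. (\<forall>v. \<omega> x u v = 0) \<longrightarrow> u = 0) \<and>
     (\<forall>u v. smooth_on U (\<lambda>x. \<omega> x u v)) \<and>
     (\<forall>x\<in>U. \<forall>u v w.
        frechet_derivative (\<lambda>y. \<omega> y v w) (at x) u
      + frechet_derivative (\<lambda>y. \<omega> y w u) (at x) v
      + frechet_derivative (\<lambda>y. \<omega> y u v) (at x) w = 0)"

text \<open>Embedded submanifolds of dimension \<open>k\<close>, by slice charts.\<close>

definition submanifold :: "nat \<Rightarrow> 'a::euclidean_space set \<Rightarrow> bool" where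
  "submanifold k L \<longleftrightarrow>
     (\<forall>z\<in>L. \<exists>W (\<phi> :: 'a \<Rightarrow> 'a) \<psi> S.
        open W \<and> z \<in> W \<and> open (\<phi> ` W) \<and>
        smooth_on W \<phi> \<and> smooth_on (\<phi> ` W) \<psi> \<and> (\<forall>x\<in>W. \<psi> (\<phi> x) = x) \<and>
        subspace S \<and> dim S = k \<and> \<phi> ` (W \<inter> L) = \<phi> ` W \<inter> S)"

definition tangent_space :: "'a::euclidean_space set \<Rightarrow> 'a \<Rightarrow> 'a set" where
  "tangent_space L z =
     {v. \<exists>\<delta>>0. \<exists>\<gamma> :: real \<Rightarrow> 'a.
           smooth_on {-\<delta><..<\<delta>} \<gamma> \<and> \<gamma> ` {-\<delta><..<\<delta>} \<subseteq> L \<and> \<gamma> 0 = z \<and>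
           (\<gamma> has_vector_derivative v) (at 0)}"

definition lagrangian_submanifold ::
    "'a::euclidean_space set \<Rightarrow> ('a \<Rightarrow> 'a \<Rightarrow> 'a \<Rightarrow> real) \<Rightarrow> 'a set \<Rightarrow> bool" where
  "lagrangian_submanifold U \<omega> L \<longleftrightarrow>
     symplectic_on U \<omega> \<and> L \<subseteq> U \<and>
     (\<exists>k. 2 * k = DIM('a) \<and> submanifold k L) \<and>
     (\<forall>z\<in>L. tangent_space L z = {u. \<forall>v \<in> tangent_space L z. \<omega> z u v = 0})"

section \<open>The standard r-matrix and the brackets on the cotangent bundle\<close>

definition wedge :: "'a::euclidean_space \<Rightarrow> 'a \<Rightarrow> 'a bivec" where
  "wedge u v \<alpha> \<beta> = blinfun_apply \<alpha> u * blinfun_apply \<beta> v - blinfun_apply \<alpha> v * blinfun_apply \<beta> u"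

text \<open>The field \<open>r\<^sub>M\<close> for \<open>r = (\<Sum>i\<in>I. X i \<and> Y i)\<close>.\<close>

definition fundamental_bivector_field ::
    "'i set \<Rightarrow> ('i \<Rightarrow> real^'n^'n) \<Rightarrow> ('i \<Rightarrow> real^'n^'n) \<Rightarrow> real^'n \<Rightarrow> (real^'n::finite) bivec" where
  "fundamental_bivector_field I X Y x \<alpha> \<beta> = (\<Sum>i\<in>I. wedge (X i *v x) (Y i *v x) \<alpha> \<beta>)"

definition matrix_unit :: "'n \<Rightarrow> 'n \<Rightarrow> real^'n^'n::finite" where
  "matrix_unit j k = (\<chi> a b. if a = j \<and> b = k then 1 else 0)"

lemma matrix_unit_mult_vec: "matrix_unit j k *v x = (x $ k) *\<^sub>R axis j 1"
  by (simp add: vec_eq_iff matrix_vector_mult_def matrix_unit_def axis_def if_distrib[of "\<lambda>c. c * _"]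
      cong: if_cong)

text \<open>The index type \<open>'n\<close>, a finite linear order, plays the role of \<open>{1, \<dots>, n}\<close> with
  \<open>n = CARD('n) \<ge> 1\<close>.\<close>

definition standard_r_field :: "real \<Rightarrow> real^'n::{finite,linorder} \<Rightarrow> (real^'n::{finite,linorder}) bivec" where
  "standard_r_field \<epsilon> =
     fundamental_bivector_field {(j, k). j < k}
       (\<lambda>(j, k). \<epsilon> *\<^sub>R matrix_unit j k) (\<lambda>(j, k). matrix_unit k j)"

text \<open>\<open>T\<^sup>*M\<close> is \<open>(real^'n) \<times> (real^'n)\<close>; the second factor consists of the coordinate vectors
  \<open>(p\<^sub>1, \<dots>, p\<^sub>n)\<close> of the elements of the dual space.\<close>

definition cx :: "'n \<Rightarrow> (real^'n) \<times> (real^'n::finite) \<Rightarrow> real" where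
  "cx j z = fst z $ j"

definition cp :: "'n \<Rightarrow> (real^'n) \<times> (real^'n::finite) \<Rightarrow> real" where
  "cp j z = snd z $ j"

text \<open>\<open>sgn (i - j)\<close> for indices.\<close>

definition sgn_diff :: "'n::linorder \<Rightarrow> 'n \<Rightarrow> real" where
  "sgn_diff i j = (if i = j then 0 else if j < i then 1 else - 1)"

definition cotangent_brackets ::
    "real \<Rightarrow>
     ((real^'n::{finite,linorder}) \<times> (real^'n::{finite,linorder}) \<Rightarrow>
       ((real^'n::{finite,linorder}) \<times> (real^'n::{finite,linorder})) bivec) \<Rightarrow> bool" where
  "cotangent_brackets \<epsilon> \<pi> \<longleftrightarrow>
     (\<forall>j k z. j < k \<longrightarrow> bracket \<pi> (cx j) (cx k) z = \<epsilon> * cx j z * cx k z) \<and>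
     (\<forall>j k z. j < k \<longrightarrow> bracket \<pi> (cp j) (cp k) z = - \<epsilon> * cp j z * cp k z) \<and>
     (\<forall>j k z. bracket \<pi> (cx j) (cp k) z =
        - (if j = k then 1 else 0)
        + \<epsilon> * (cx j z * cp k z
               + (if j = k then 1 else 0) * (\<Sum>i\<in>UNIV. (1 - sgn_diff i j) * cx i z * cp i z)))"

end

theory Submission
  imports Defs
begin

text \<open>The Jacobiator of a bi-vector field is tensorial, since the second derivatives cancel by
  symmetry; hence the Jacobi identity need only be checked on linear coordinates. For the brackets
  on \<open>T\<^sup>*M\<close> all pairs of coordinates except \<open>(x\<^sup>j, p\<^sub>j)\<close> are log-canonical, and the diagonal terms
  \<open>\<phi>\<^sub>j = - 1 + \<epsilon> (\<Sum>i. (1 - sgn (i - j)) x\<^sup>i p\<^sub>i)\<close> satisfy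
  \<open>{x\<^sup>k, \<phi>\<^sub>j} = \<epsilon> (1 - sgn (k - j)) x\<^sup>k \<phi>\<^sub>j\<close> and
  \<open>{p\<^sub>k, \<phi>\<^sub>j} = - \<epsilon> (1 - sgn (k - j)) p\<^sub>k \<phi>\<^sub>j\<close> for \<open>k \<noteq> j\<close>; this settles the remaining triples.
  Where \<open>x = 0\<close> or \<open>p = 0\<close>, the Poisson matrix is block-triangular with blocks \<open>\<plusminus> 1\<close> off the
  diagonal, hence invertible. On the open set where it is invertible, \<open>d\<omega>(u, v, w)\<close> is the Jacobiator
  evaluated on the covectors that correspond to \<open>u, w, v\<close>.\<close>

section \<open>Calculus of smooth functions\<close>

text \<open>The brackets are prescribed on pairs of coordinates only, while the definitions quantify
  over all smooth functions and all covectors. The bridge is that a linear function has constant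
  differential, so every covector is the differential of a function with vanishing second
  derivatives. The analytic obstacle is the dependence of the inverse of \<pi> on the point. One
  formula, giving the derivative of \<omega> as an expression quadratic in \<omega> and linear in
  the derivative of \<pi>, serves twice: an induction on it yields smoothness, and its cyclic sum
  yields closedness. The weights 1 - sgn(i - j) equal 2, 1, 0 for i < j, i = j, i > j. The
  proportionality of {x^k, \<phi>_j} to x^k \<phi>_j rests on one identity between three such
  weights, in which the constant -1 of \<phi>_j is reproduced by the -1 of \<phi>_k. On either axis
  every product x^j p_k vanishes, so each \<phi>_j equals -1 there and the mixed part of \<pi> is
  the canonical one.\<close>

lemma C_diff_on_SucD: "C_diff_on (Suc k) U f \<Longrightarrow> C_diff_on k U f"
proof (induction k arbitrary: f)
  case 0
  then show ?case
    by (auto intro!: continuous_at_imp_continuous_on differentiable_imp_continuous_within)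
next
  case (Suc k)
  then show ?case by fastforce
qed

lemma smooth_on_frechet_derivative:
  "smooth_on U f \<Longrightarrow> smooth_on U (\<lambda>x. frechet_derivative f (at x) v)"
  unfolding smooth_on_def by (metis C_diff_on.simps(2))

lemma smooth_on_differentiable: "smooth_on U f \<Longrightarrow> x \<in> U \<Longrightarrow> f differentiable (at x)"
  unfolding smooth_on_def by (metis C_diff_on.simps(2))

lemma smooth_on_continuous_on: "smooth_on U f \<Longrightarrow> continuous_on U f"
  unfolding smooth_on_def by (metis C_diff_on.simps(1))

text \<open>Agreement on an open set passes to the Frechet derivatives at its points. This allows
  derivative formulas valid only on \<open>U\<close> to be substituted inside
  \<open>C_diff_on\<close>.\<close>

lemma C_diff_on_cong:
  fixes f g :: "'a::real_normed_vector \<Rightarrow> 'b::real_normed_vector"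
  assumes "open U" "\<And>x. x \<in> U \<Longrightarrow> f x = g x"
  shows "C_diff_on k U f \<longleftrightarrow> C_diff_on k U g"
  using assms(2)
proof (induction k arbitrary: f g)
  case 0
  then show ?case by (auto cong: continuous_on_cong)
next
  case (Suc k)
  have imp: "C_diff_on (Suc k) U g" if f: "C_diff_on (Suc k) U f" and fg: "\<And>x. x \<in> U \<Longrightarrow> f x = g x"
    for f g :: "'a \<Rightarrow> 'b"
  proof -
    have d: "f differentiable (at x)" if "x \<in> U" for x
      using f that by simp
    have g: "g differentiable (at x)" if "x \<in> U" for x
      using d[OF that] that fg \<open>open U\<close>
      by (metis differentiable_def has_derivative_transform_within_open)
    have eq: "frechet_derivative f (at x) = frechet_derivative g (at x)" if "x \<in> U" for x
      by (rule frechet_derivative_transform_within_open[OF d \<open>open U\<close>]) (use that fg in auto)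
    have "C_diff_on k U (\<lambda>x. frechet_derivative f (at x) v)
        \<longleftrightarrow> C_diff_on k U (\<lambda>x. frechet_derivative g (at x) v)" for v
      by (rule Suc.IH) (simp add: eq)
    then show ?thesis using f g by simp
  qed
  show ?case using imp[of f g] imp[of g f] Suc.prems by metis
qed

lemma frechet_derivative_eq: "(f has_derivative f') (at x) \<Longrightarrow> frechet_derivative f (at x) = f'"
  using frechet_derivative_at by metis

lemma C_diff_on_const: "C_diff_on k U (\<lambda>x. c)"
  by (induction k arbitrary: c) simp_all

lemma C_diff_on_bounded_linear: "bounded_linear f \<Longrightarrow> C_diff_on k U f"
proof (cases k)
  case 0
  moreover assume "bounded_linear f"
  ultimately show ?thesis by (simp add: linear_continuous_on)
next
  case (Suc m)
  assume f: "bounded_linear f"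
  then have "frechet_derivative f (at x) = f" for x
    by (intro frechet_derivative_eq bounded_linear_imp_has_derivative)
  with Suc f show ?thesis
    by (auto simp: C_diff_on_const bounded_linear_imp_differentiable)
qed

lemma C_diff_on_add:
  assumes "open U" "C_diff_on k U f" "C_diff_on k U g"
  shows "C_diff_on k U (\<lambda>x. f x + g x)"
  using assms(2,3)
proof (induction k arbitrary: f g)
  case 0
  then show ?case by (simp add: continuous_on_add)
next
  case (Suc k)
  have "frechet_derivative (\<lambda>x. f x + g x) (at x) v
      = frechet_derivative f (at x) v + frechet_derivative g (at x) v" if "x \<in> U" for x v
    using Suc.prems that
    by (subst frechet_derivative_eq[OF has_derivative_add[OF frechet_derivative_works[THEN iffD1] frechet_derivative_works[THEN iffD1]]]) auto
  moreover have "C_diff_on k U (\<lambda>x. frechet_derivative f (at x) v + frechet_derivative g (at x) v)" for v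
    using Suc by simp
  ultimately have "C_diff_on k U (\<lambda>x. frechet_derivative (\<lambda>x. f x + g x) (at x) v)" for v
    by (subst C_diff_on_cong[OF \<open>open U\<close>]) auto
  then show ?case using Suc.prems by (simp add: differentiable_add)
qed

lemma C_diff_on_mult:
  fixes f g :: "'a::real_normed_vector \<Rightarrow> real"
  assumes "open U" "C_diff_on k U f" "C_diff_on k U g"
  shows "C_diff_on k U (\<lambda>x. f x * g x)"
  using assms(2,3)
proof (induction k arbitrary: f g)
  case 0
  then show ?case by (simp add: continuous_on_mult)
next
  case (Suc k)
  have "frechet_derivative (\<lambda>x. f x * g x) (at x) v
      = f x * frechet_derivative g (at x) v + frechet_derivative f (at x) v * g x" if "x \<in> U" for x v
    using Suc.prems that
    by (subst frechet_derivative_eq[OF has_derivative_mult[OF frechet_derivative_works[THEN iffD1] frechet_derivative_works[THEN iffD1]]]) auto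
  moreover have "C_diff_on k U (\<lambda>x. f x * frechet_derivative g (at x) v + frechet_derivative f (at x) v * g x)" for v
    using Suc.prems Suc.prems[THEN C_diff_on_SucD] by (intro C_diff_on_add \<open>open U\<close> Suc.IH) simp_all
  ultimately have "C_diff_on k U (\<lambda>x. frechet_derivative (\<lambda>x. f x * g x) (at x) v)" for v
    by (subst C_diff_on_cong[OF \<open>open U\<close>]) auto
  then show ?case using Suc.prems by (simp add: differentiable_mult)
qed

lemma C_diff_on_sum:
  assumes "open U" "\<And>i. i \<in> I \<Longrightarrow> C_diff_on k U (f i)"
  shows "C_diff_on k U (\<lambda>x. \<Sum>i\<in>I. f i x)"
  using assms(2)
  by (induction I rule: infinite_finite_induct) (auto intro: C_diff_on_const C_diff_on_add[OF assms(1)])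

lemma C_diff_on_subset: "C_diff_on k U f \<Longrightarrow> V \<subseteq> U \<Longrightarrow> C_diff_on k V f"
  by (induction k arbitrary: f) (auto intro: continuous_on_subset)

lemma smooth_on_const: "smooth_on U (\<lambda>x. c)"
  by (simp add: smooth_on_def C_diff_on_const)

lemma smooth_on_bounded_linear: "bounded_linear f \<Longrightarrow> smooth_on U f"
  by (simp add: smooth_on_def C_diff_on_bounded_linear)

lemma smooth_on_add: "open U \<Longrightarrow> smooth_on U f \<Longrightarrow> smooth_on U g \<Longrightarrow> smooth_on U (\<lambda>x. f x + g x)"
  by (simp add: smooth_on_def C_diff_on_add)

lemma smooth_on_mult:
  fixes f g :: "'a::real_normed_vector \<Rightarrow> real"
  shows "open U \<Longrightarrow> smooth_on U f \<Longrightarrow> smooth_on U g \<Longrightarrow> smooth_on U (\<lambda>x. f x * g x)"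
  by (simp add: smooth_on_def C_diff_on_mult)

lemma smooth_on_sum:
  "open U \<Longrightarrow> (\<And>i. i \<in> I \<Longrightarrow> smooth_on U (f i)) \<Longrightarrow> smooth_on U (\<lambda>x. \<Sum>i\<in>I. f i x)"
  by (simp add: smooth_on_def C_diff_on_sum)

section \<open>Symmetry of second derivatives\<close>

lemma has_real_derivative_along_line:
  fixes f :: "'a::real_normed_vector \<Rightarrow> real"
  assumes "f differentiable (at (a + t *\<^sub>R u))"
  shows "((\<lambda>s. f (a + s *\<^sub>R u)) has_real_derivative frechet_derivative f (at (a + t *\<^sub>R u)) u) (at t)"
proof -
  have "((\<lambda>s. a + s *\<^sub>R u) has_derivative (\<lambda>s. s *\<^sub>R u)) (at t)"
    by (auto intro!: derivative_eq_intros)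
  from diff_chain_at[OF this assms[unfolded frechet_derivative_works]]
  have "((\<lambda>s. f (a + s *\<^sub>R u)) has_derivative
      (\<lambda>s. frechet_derivative f (at (a + t *\<^sub>R u)) (s *\<^sub>R u))) (at t)"
    by (simp add: o_def)
  then show ?thesis
    using linear_frechet_derivative[OF assms]
    by (simp add: has_field_derivative_def linear_cmul mult_commute_abs)
qed

text \<open>The mean value theorem is applied twice: in direction u to the difference of f along two
  parallel segments that are h v apart, then in direction v to the derivative of f along u. The left
  side is symmetric in u and v, the right side is a single mixed derivative.\<close>

lemma second_difference_mean_value:
  fixes f :: "'a::real_normed_vector \<Rightarrow> real"
  assumes f: "\<And>y. f differentiable (at y)"
    and fu: "\<And>y. (\<lambda>y. frechet_derivative f (at y) u) differentiable (at y)"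
    and "0 < h"
  shows "\<exists>s\<in>{0<..<h}. \<exists>t\<in>{0<..<h}.
     f (x + h *\<^sub>R u + h *\<^sub>R v) - f (x + h *\<^sub>R u) - f (x + h *\<^sub>R v) + f x =
     h\<^sup>2 * frechet_derivative (\<lambda>y. frechet_derivative f (at y) u) (at (x + s *\<^sub>R u + t *\<^sub>R v)) v"
proof -
  let ?Du = "\<lambda>y. frechet_derivative f (at y) u"
  let ?g = "\<lambda>s. f ((x + h *\<^sub>R v) + s *\<^sub>R u) - f (x + s *\<^sub>R u)"
  have "DERIV ?g s :> ?Du ((x + h *\<^sub>R v) + s *\<^sub>R u) - ?Du (x + s *\<^sub>R u)" for s
    by (intro DERIV_diff has_real_derivative_along_line f)
  from MVT2[OF \<open>0 < h\<close> this] obtain s where s: "0 < s" "s < h"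
    and gs: "?g h - ?g 0 = (h - 0) * (?Du ((x + h *\<^sub>R v) + s *\<^sub>R u) - ?Du (x + s *\<^sub>R u))"
    by blast
  let ?k = "\<lambda>t. ?Du ((x + s *\<^sub>R u) + t *\<^sub>R v)"
  have "DERIV ?k t :> frechet_derivative ?Du (at ((x + s *\<^sub>R u) + t *\<^sub>R v)) v" for t
    by (intro has_real_derivative_along_line fu)
  from MVT2[OF \<open>0 < h\<close> this] obtain t where t: "0 < t" "t < h"
    and kt: "?k h - ?k 0 = (h - 0) * frechet_derivative ?Du (at ((x + s *\<^sub>R u) + t *\<^sub>R v)) v"
    by blast
  have "?g h - ?g 0 = h * (?k h - ?k 0)"
    using gs by (simp add: algebra_simps)
  then have "?g h - ?g 0 = h\<^sup>2 * frechet_derivative ?Du (at ((x + s *\<^sub>R u) + t *\<^sub>R v)) v"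
    unfolding kt by (simp add: power2_eq_square)
  with s t show ?thesis by (intro bexI[of _ s] bexI[of _ t]) (auto simp: algebra_simps)
qed

text \<open>Exchanging u and v leaves the second difference unchanged, so the two mixed derivatives
  take a common value at points arbitrarily close to x. Their continuity then forces equality at
  x.\<close>

lemma second_derivative_symmetric:
  fixes f :: "'a::real_normed_vector \<Rightarrow> real"
  assumes f: "C_diff_on 2 UNIV f"
  shows "frechet_derivative (\<lambda>y. frechet_derivative f (at y) u) (at x) v
       = frechet_derivative (\<lambda>y. frechet_derivative f (at y) v) (at x) u"
proof -
  define D where "D a b y = frechet_derivative (\<lambda>y. frechet_derivative f (at y) a) (at y) b" for a b y
  have 1: "f differentiable (at y)" for y
    using f by (simp add: numeral_2_eq_2)
  have 2: "(\<lambda>y. frechet_derivative f (at y) a) differentiable (at y)" for y a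
    using f by (simp add: numeral_2_eq_2)
  have cont: "continuous_on UNIV (D a b)" for a b
    using f by (simp add: numeral_2_eq_2 D_def)
  have le: "\<bar>D u v x - D v u x\<bar> \<le> e" if "0 < e" for e
  proof -
    have *: "\<exists>d>0. \<forall>y. dist y x < d \<longrightarrow> \<bar>D a b y - D a b x\<bar> < e / 2" for a b
      using cont[of a b] \<open>0 < e\<close> unfolding continuous_on_iff dist_real_def
      by (metis UNIV_I half_gt_zero)
    obtain d1 where d1: "d1 > 0" "\<And>y. dist y x < d1 \<Longrightarrow> \<bar>D u v y - D u v x\<bar> < e / 2" using * by metis
    obtain d2 where d2: "d2 > 0" "\<And>y. dist y x < d2 \<Longrightarrow> \<bar>D v u y - D v u x\<bar> < e / 2" using * by metis
    \<comment> \<open>Any intermediate point lies within h (|u| + |v|) of x. The summand 1 keeps the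
      quotient defined when u = v = 0 and makes this bound strict.\<close>
    define h where "h = min d1 d2 / (norm u + norm v + 1)"
    have h: "0 < h" using d1 d2 by (simp add: h_def add_nonneg_pos)
    have hd: "h * (norm u + norm v) < min d1 d2"
    proof -
      have "norm u + norm v + 1 \<noteq> 0"
        by (metis add_nonneg_pos less_numeral_extra(1,3) norm_ge_zero add_nonneg_nonneg)
      then have "h * (norm u + norm v + 1) = min d1 d2" by (simp add: h_def)
      then show ?thesis using h by (simp only: distrib_left[of h "_ + _" 1])
    qed
    have near: "dist (x + s *\<^sub>R a + t *\<^sub>R b) x < min d1 d2"
      if "s \<in> {0<..<h}" "t \<in> {0<..<h}" "{a,b} = {u,v}" for s t a b
    proof -
      have "dist (x + s *\<^sub>R a + t *\<^sub>R b) x = norm (s *\<^sub>R a + t *\<^sub>R b)"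
        by (simp add: dist_norm add.assoc)
      also have "\<dots> \<le> norm (s *\<^sub>R a) + norm (t *\<^sub>R b)"
        by (rule norm_triangle_ineq)
      also have "\<dots> \<le> h * norm a + h * norm b"
        using that by (auto intro!: add_mono mult_right_mono)
      also have "\<dots> = h * (norm u + norm v)"
        using that(3) by (auto simp: doubleton_eq_iff algebra_simps)
      finally show ?thesis using hd by simp
    qed
    obtain s t where st: "s \<in> {0<..<h}" "t \<in> {0<..<h}"
      "f (x + h *\<^sub>R u + h *\<^sub>R v) - f (x + h *\<^sub>R u) - f (x + h *\<^sub>R v) + f x = h\<^sup>2 * D u v (x + s *\<^sub>R u + t *\<^sub>R v)"
      using second_difference_mean_value[OF 1 2 h] unfolding D_def by blast
    obtain s' t' where st': "s' \<in> {0<..<h}" "t' \<in> {0<..<h}"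
      "f (x + h *\<^sub>R v + h *\<^sub>R u) - f (x + h *\<^sub>R v) - f (x + h *\<^sub>R u) + f x = h\<^sup>2 * D v u (x + s' *\<^sub>R v + t' *\<^sub>R u)"
      using second_difference_mean_value[OF 1 2 h] unfolding D_def by blast
    note st(3)[symmetric]
    also have "f (x + h *\<^sub>R u + h *\<^sub>R v) - f (x + h *\<^sub>R u) - f (x + h *\<^sub>R v) + f x =
        f (x + h *\<^sub>R v + h *\<^sub>R u) - f (x + h *\<^sub>R v) - f (x + h *\<^sub>R u) + f x"
      by (simp add: add_ac)
    also note st'(3)
    finally have "h\<^sup>2 * D u v (x + s *\<^sub>R u + t *\<^sub>R v) = h\<^sup>2 * D v u (x + s' *\<^sub>R v + t' *\<^sub>R u)" .
    then have "D u v (x + s *\<^sub>R u + t *\<^sub>R v) = D v u (x + s' *\<^sub>R v + t' *\<^sub>R u)"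
      using h by simp
    moreover have "\<bar>D u v (x + s *\<^sub>R u + t *\<^sub>R v) - D u v x\<bar> < e / 2"
      using near[OF st(1,2)] by (intro d1) auto
    moreover have "\<bar>D v u (x + s' *\<^sub>R v + t' *\<^sub>R u) - D v u x\<bar> < e / 2"
      using near[OF st'(1,2)] by (intro d2) auto
    ultimately show ?thesis by linarith
  qed
  have "\<bar>D u v x - D v u x\<bar> \<le> 0"
    by (rule field_le_epsilon) (simp only: add_0 le)
  then show ?thesis by (simp add: D_def)
qed

section \<open>The Jacobiator\<close>

lemma blinfun_apply_differential:
  "f differentiable (at x) \<Longrightarrow> blinfun_apply (differential f x) = frechet_derivative f (at x)"
  unfolding differential_def
  by (intro bounded_linear_Blinfun_apply) (metis frechet_derivative_works has_derivative_bounded_linear)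

lemma frechet_derivative_bounded_linear: "bounded_linear f \<Longrightarrow> frechet_derivative f (at x) = f"
  by (intro frechet_derivative_eq bounded_linear_imp_has_derivative)

lemma differential_blinfun_apply: "differential (blinfun_apply \<alpha>) x = \<alpha>"
  by (simp add: differential_def frechet_derivative_bounded_linear blinfun.bounded_linear_right
      blinfun_apply_inverse)

lemma smooth_on_blinfun_apply: "smooth_on U (blinfun_apply \<alpha>)"
  by (simp add: smooth_on_bounded_linear blinfun.bounded_linear_right)

section \<open>Covectors, bi-vectors and their coefficients\<close>

lemma covector_expansion:
  fixes \<alpha> :: "'a::euclidean_space \<Rightarrow>\<^sub>L real"
  shows "\<alpha> = (\<Sum>b\<in>Basis. blinfun_apply \<alpha> b *\<^sub>R blinfun_inner_right b)"
  by (rule blinfun_euclidean_eqI)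
    (simp add: blinfun.sum_left blinfun.scaleR_left blinfun_inner_right.rep_eq inner_Basis if_distrib
      cong: if_cong)

lemma linear_covector_eqI:
  fixes L M :: "('a::euclidean_space \<Rightarrow>\<^sub>L real) \<Rightarrow> 'b::real_vector"
  assumes "linear L" "linear M" "\<And>b. b \<in> Basis \<Longrightarrow> L (blinfun_inner_right b) = M (blinfun_inner_right b)"
  shows "L = M"
proof
  fix \<alpha>
  show "L \<alpha> = M \<alpha>"
    by (subst (1 2) covector_expansion) (simp add: assms linear_sum linear_cmul)
qed

text \<open>The vector that represents \<open>P \<alpha>\<close> under the identification of the
  bidual with the space itself. For \<alpha> = df it is the Hamiltonian vector of f, with the
  convention that {f, g} is the derivative of g along it.\<close>

definition sharp :: "('a::euclidean_space) bivec \<Rightarrow> ('a \<Rightarrow>\<^sub>L real) \<Rightarrow> 'a" where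
  "sharp P \<alpha> = (\<Sum>b\<in>Basis. P \<alpha> (blinfun_inner_right b) *\<^sub>R b)"

lemma bounded_bilinear_linear_left: "bounded_bilinear P \<Longrightarrow> linear (\<lambda>x. P x y)"
  and bounded_bilinear_linear_right: "bounded_bilinear P \<Longrightarrow> linear (P x)"
  by (simp_all add: bounded_bilinear.bounded_linear_left bounded_bilinear.bounded_linear_right
      bounded_linear.linear)

lemma blinfun_apply_sharp:
  assumes "bounded_bilinear P"
  shows "blinfun_apply \<beta> (sharp P \<alpha>) = P \<alpha> \<beta>"
proof -
  have "linear (\<lambda>\<beta>. blinfun_apply \<beta> (sharp P \<alpha>))"
    by (simp add: bounded_linear.linear)
  moreover have "linear (P \<alpha>)"
    using assms by (rule bounded_bilinear_linear_right)
  ultimately have "(\<lambda>\<beta>. blinfun_apply \<beta> (sharp P \<alpha>)) = P \<alpha>"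
    by (rule linear_covector_eqI)
      (simp add: blinfun_inner_right.rep_eq sharp_def inner_sum_right inner_Basis if_distrib cong: if_cong)
  then show ?thesis by (rule fun_cong)
qed

lemma linear_sharp: "bounded_bilinear P \<Longrightarrow> linear (sharp P)"
  unfolding sharp_def
  by (intro linearI) (simp_all add: bounded_bilinear.add_left bounded_bilinear.scaleR_left
      algebra_simps sum.distrib scaleR_right.sum)

lemma bivec_expansion:
  fixes \<alpha> \<beta> :: "'a::euclidean_space \<Rightarrow>\<^sub>L real"
  assumes "bounded_bilinear P"
  shows "P \<alpha> \<beta> = (\<Sum>a\<in>Basis. \<Sum>b\<in>Basis. blinfun_apply \<alpha> a * blinfun_apply \<beta> b *
    P (blinfun_inner_right a) (blinfun_inner_right b))"
proof -
  have "P \<alpha> \<beta> = P (\<Sum>a\<in>Basis. blinfun_apply \<alpha> a *\<^sub>R blinfun_inner_right a)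
      (\<Sum>b\<in>Basis. blinfun_apply \<beta> b *\<^sub>R blinfun_inner_right b)"
    by (metis covector_expansion)
  then show ?thesis
    unfolding bounded_bilinear.sum_left[OF assms] bounded_bilinear.scaleR_left[OF assms]
      bounded_bilinear.sum_right[OF assms] bounded_bilinear.scaleR_right[OF assms]
    by (subst sum.swap) (simp add: sum_distrib_left mult_ac)
qed

text \<open>The part of {f, {g, h}} without second derivatives, where \<alpha>, \<beta>, \<gamma>
  are the differentials of f, g, h: only the coefficients of \<pi> are differentiated.\<close>

definition half_jacobiator ::
    "('a::euclidean_space \<Rightarrow> 'a bivec) \<Rightarrow> 'a \<Rightarrow>
      ('a \<Rightarrow>\<^sub>L real) \<Rightarrow> ('a \<Rightarrow>\<^sub>L real) \<Rightarrow> ('a \<Rightarrow>\<^sub>L real) \<Rightarrow> real" where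
  "half_jacobiator \<pi> x \<alpha> \<beta> \<gamma> = frechet_derivative (\<lambda>y. \<pi> y \<beta> \<gamma>) (at x) (sharp (\<pi> x) \<alpha>)"

text \<open>Up to a constant factor this is the Schouten bracket of \<pi> with itself, evaluated on
  three covectors.\<close>

definition jacobiator ::
    "('a::euclidean_space \<Rightarrow> 'a bivec) \<Rightarrow> 'a \<Rightarrow>
      ('a \<Rightarrow>\<^sub>L real) \<Rightarrow> ('a \<Rightarrow>\<^sub>L real) \<Rightarrow> ('a \<Rightarrow>\<^sub>L real) \<Rightarrow> real" where
  "jacobiator \<pi> x \<alpha> \<beta> \<gamma> =
     half_jacobiator \<pi> x \<alpha> \<beta> \<gamma> + half_jacobiator \<pi> x \<beta> \<gamma> \<alpha> + half_jacobiator \<pi> x \<gamma> \<alpha> \<beta>"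

context
  fixes \<pi> :: "'a::euclidean_space \<Rightarrow> 'a bivec"
  assumes \<pi>: "bivector_field \<pi>"
begin

lemma bivector_field_bilinear: "bounded_bilinear (\<pi> x)"
  and bivector_field_alternating: "\<pi> x \<alpha> \<alpha> = 0"
  and bivector_field_smooth: "smooth_on UNIV (\<lambda>x. \<pi> x \<alpha> \<beta>)"
  using \<pi> unfolding bivector_field_def by auto

lemma bivector_field_differentiable: "(\<lambda>x. \<pi> x \<alpha> \<beta>) differentiable (at x)"
  using bivector_field_smooth by (rule smooth_on_differentiable) simp

lemma bivector_field_antisym: "\<pi> x \<alpha> \<beta> = - \<pi> x \<beta> \<alpha>"
proof -
  have "\<pi> x (\<alpha> + \<beta>) (\<alpha> + \<beta>) = \<pi> x \<alpha> \<alpha> + \<pi> x \<alpha> \<beta> + (\<pi> x \<beta> \<alpha> + \<pi> x \<beta> \<beta>)"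
    by (simp only: bounded_bilinear.add_left[OF bivector_field_bilinear]
      bounded_bilinear.add_right[OF bivector_field_bilinear])
  then show ?thesis by (simp add: bivector_field_alternating)
qed

lemma bracket_antisym: "bracket \<pi> f g x = - bracket \<pi> g f x"
  unfolding bracket_def by (rule bivector_field_antisym)

lemma bracket_self: "bracket \<pi> f f x = 0"
  unfolding bracket_def by (rule bivector_field_alternating)

lemma bracket_eq_derivative:
  "g differentiable (at x) \<Longrightarrow>
    bracket \<pi> f g x = frechet_derivative g (at x) (sharp (\<pi> x) (differential f x))"
  by (simp add: bracket_def blinfun_apply_sharp[OF bivector_field_bilinear, symmetric]
      blinfun_apply_differential)

lemma bracket_add_right:
  assumes "g differentiable (at x)" "h differentiable (at x)"
  shows "bracket \<pi> f (\<lambda>y. g y + h y) x = bracket \<pi> f g x + bracket \<pi> f h x"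
  using assms frechet_derivative_eq[OF has_derivative_add[OF assms[unfolded frechet_derivative_works]]]
  by (simp add: bracket_eq_derivative differentiable_add)

lemma bracket_mult_right:
  assumes "g differentiable (at x)" "h differentiable (at x)"
  shows "bracket \<pi> f (\<lambda>y. g y * h y) x = g x * bracket \<pi> f h x + bracket \<pi> f g x * h x"
  using assms frechet_derivative_eq[OF has_derivative_mult[OF assms[unfolded frechet_derivative_works]]]
  by (simp add: bracket_eq_derivative differentiable_mult)

lemma bracket_const_right: "bracket \<pi> f (\<lambda>y. c) x = 0"
  by (simp add: bracket_eq_derivative)

lemma bracket_cmult_right:
  "g differentiable (at x) \<Longrightarrow> bracket \<pi> f (\<lambda>y. c * g y) x = c * bracket \<pi> f g x"
  by (simp add: bracket_mult_right bracket_const_right)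

lemma bracket_minus_right:
  "g differentiable (at x) \<Longrightarrow> bracket \<pi> f (\<lambda>y. - g y) x = - bracket \<pi> f g x"
  using bracket_cmult_right[of g x f "- 1"] by simp

lemma bracket_sum_right:
  assumes "finite I" "\<And>i. i \<in> I \<Longrightarrow> g i differentiable (at x)"
  shows "bracket \<pi> f (\<lambda>y. \<Sum>i\<in>I. g i y) x = (\<Sum>i\<in>I. bracket \<pi> f (g i) x)"
  using assms
proof (induction I rule: finite_induct)
  case empty
  then show ?case by (simp add: bracket_const_right)
next
  case (insert i I)
  then show ?case by (simp add: bracket_add_right differentiable_sum)
qed

section \<open>Tensoriality of the Jacobiator\<close>

lemma frechet_derivative_bivector_field:
  "frechet_derivative (\<lambda>y. \<pi> y \<alpha> \<beta>) (at x) v =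
    (\<Sum>a\<in>Basis. \<Sum>b\<in>Basis. blinfun_apply \<alpha> a * blinfun_apply \<beta> b *
      frechet_derivative (\<lambda>y. \<pi> y (blinfun_inner_right a) (blinfun_inner_right b)) (at x) v)"
proof -
  have "((\<lambda>y. \<pi> y \<alpha> \<beta>) has_derivative
    (\<lambda>v. \<Sum>a\<in>Basis. \<Sum>b\<in>Basis. (blinfun_apply \<alpha> a * blinfun_apply \<beta> b) *
      frechet_derivative (\<lambda>y. \<pi> y (blinfun_inner_right a) (blinfun_inner_right b)) (at x) v)) (at x)"
    by (subst bivec_expansion[OF bivector_field_bilinear])
      (intro has_derivative_sum has_derivative_mult_right
        bivector_field_differentiable[unfolded frechet_derivative_works])
  then show ?thesis by (simp add: frechet_derivative_eq)
qed

lemma frechet_derivative_bracket: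
  assumes f: "smooth_on UNIV f" and g: "smooth_on UNIV g"
  shows "bracket \<pi> f g differentiable (at x)"
    and "frechet_derivative (bracket \<pi> f g) (at x) v =
      frechet_derivative (\<lambda>y. \<pi> y (differential f x) (differential g x)) (at x) v
      + \<pi> x (differential (\<lambda>y. frechet_derivative f (at y) v) x) (differential g x)
      + \<pi> x (differential f x) (differential (\<lambda>y. frechet_derivative g (at y) v) x)"
proof -
  let ?e = "blinfun_inner_right :: 'a \<Rightarrow> 'a \<Rightarrow>\<^sub>L real"
  let ?D = "\<lambda>f v y. frechet_derivative f (at y) v"
  have df: "f differentiable (at y)" "g differentiable (at y)" for y
    using f g by (auto intro: smooth_on_differentiable)
  have ddf: "?D f v differentiable (at y)" "?D g v differentiable (at y)" for y v
    using f g by (auto intro: smooth_on_differentiable smooth_on_frechet_derivative)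
  have eq: "bracket \<pi> f g =
      (\<lambda>y. \<Sum>a\<in>Basis. \<Sum>b\<in>Basis. ?D f a y * ?D g b y * \<pi> y (?e a) (?e b))"
    unfolding bracket_def
    by (subst bivec_expansion[OF bivector_field_bilinear]) (simp add: blinfun_apply_differential df)
  have der: "(bracket \<pi> f g has_derivative (\<lambda>v. \<Sum>a\<in>Basis. \<Sum>b\<in>Basis.
      (?D f a x * ?D g b x) * ?D (\<lambda>y. \<pi> y (?e a) (?e b)) v x
       + (?D f a x * ?D (?D g b) v x + ?D (?D f a) v x * ?D g b x) * \<pi> x (?e a) (?e b))) (at x)"
    unfolding eq
    by (intro has_derivative_sum has_derivative_mult ddf[unfolded frechet_derivative_works]
        bivector_field_differentiable[unfolded frechet_derivative_works])
  then show "bracket \<pi> f g differentiable (at x)"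
    by (rule differentiableI)
  \<comment> \<open>The product rule produces derivatives of \<open>D_a f\<close> in direction v.
    Only after the order is exchanged are they the coefficients of the differential of the single
    function \<open>D_v f\<close>.\<close>
  have symf: "?D (?D f a) v x = ?D (?D f v) a x" for a
    by (rule second_derivative_symmetric) (use f in \<open>simp add: smooth_on_def del: C_diff_on.simps\<close>)
  have symg: "?D (?D g a) v x = ?D (?D g v) a x" for a
    by (rule second_derivative_symmetric) (use g in \<open>simp add: smooth_on_def del: C_diff_on.simps\<close>)
  have 1: "frechet_derivative (\<lambda>y. \<pi> y (differential f x) (differential g x)) (at x) v
     = (\<Sum>a\<in>Basis. \<Sum>b\<in>Basis. (?D f a x * ?D g b x) * ?D (\<lambda>y. \<pi> y (?e a) (?e b)) v x)"
    by (subst frechet_derivative_bivector_field) (simp add: blinfun_apply_differential df)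
  have 2: "\<pi> x (differential (?D f v) x) (differential g x)
     = (\<Sum>a\<in>Basis. \<Sum>b\<in>Basis. ?D (?D f a) v x * ?D g b x * \<pi> x (?e a) (?e b))"
    by (subst bivec_expansion[OF bivector_field_bilinear])
      (simp add: blinfun_apply_differential df ddf symf)
  have 3: "\<pi> x (differential f x) (differential (?D g v) x)
     = (\<Sum>a\<in>Basis. \<Sum>b\<in>Basis. ?D f a x * ?D (?D g b) v x * \<pi> x (?e a) (?e b))"
    by (subst bivec_expansion[OF bivector_field_bilinear])
      (simp add: blinfun_apply_differential df ddf symg)
  show "frechet_derivative (bracket \<pi> f g) (at x) v =
      frechet_derivative (\<lambda>y. \<pi> y (differential f x) (differential g x)) (at x) v
      + \<pi> x (differential (?D f v) x) (differential g x)
      + \<pi> x (differential f x) (differential (?D g v) x)"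
    unfolding frechet_derivative_eq[OF der] 1 2 3
    by (simp add: sum.distrib algebra_simps)
qed

lemma jacobi_sum_eq_jacobiator:
  assumes f: "smooth_on UNIV f" and g: "smooth_on UNIV g" and h: "smooth_on UNIV h"
  shows "bracket \<pi> f (bracket \<pi> g h) x + bracket \<pi> g (bracket \<pi> h f) x + bracket \<pi> h (bracket \<pi> f g) x
    = jacobiator \<pi> x (differential f x) (differential g x) (differential h x)"
proof -
  let ?D = "\<lambda>f v y. frechet_derivative f (at y) v"
  let ?s = "\<lambda>f. sharp (\<pi> x) (differential f x)"
  define H where "H f u v = ?D (?D f u) v x" for f :: "'a \<Rightarrow> real" and u v
  have sym: "H f u v = H f v u" if "smooth_on UNIV f" for f :: "'a \<Rightarrow> real" and u v
    unfolding H_def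
    by (rule second_derivative_symmetric) (use that in \<open>simp add: smooth_on_def del: C_diff_on.simps\<close>)
  have *: "\<pi> x (differential k x) (differential (?D f v) x) = H f v (?s k)" if "smooth_on UNIV f" for f k v
    unfolding H_def using smooth_on_differentiable[OF smooth_on_frechet_derivative[OF that]]
    by (simp add: blinfun_apply_sharp[OF bivector_field_bilinear, symmetric] blinfun_apply_differential)
  \<comment> \<open>Each nested bracket carries two Hessian terms of opposite sign. In the cyclic
    sum the Hessian of g occurs as -H(f#, h#) here and as +H(h#, f#) in {h, {f, g}}, and likewise
    for f and h, where # denotes the Hamiltonian vector; symmetry of H cancels the pairs.\<close>
  have "bracket \<pi> f (bracket \<pi> g h) x =
      half_jacobiator \<pi> x (differential f x) (differential g x) (differential h x)
      - H g (?s f) (?s h) + H h (?s f) (?s g)"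
    if g: "smooth_on UNIV g" and h: "smooth_on UNIV h" for f g h
    using bivector_field_antisym[of x "differential (?D g (?s f)) x" "differential h x"]
    by (simp add: bracket_eq_derivative frechet_derivative_bracket g h half_jacobiator_def *)
  then show ?thesis
    using sym[OF f, of "?s g" "?s h"] sym[OF g, of "?s f" "?s h"] sym[OF h, of "?s f" "?s g"]
    by (simp add: jacobiator_def f g h)
qed

lemma jacobiator_eq_jacobi_sum_linear:
  "jacobiator \<pi> x \<alpha> \<beta> \<gamma> =
    bracket \<pi> (blinfun_apply \<alpha>) (bracket \<pi> (blinfun_apply \<beta>) (blinfun_apply \<gamma>)) x
  + bracket \<pi> (blinfun_apply \<beta>) (bracket \<pi> (blinfun_apply \<gamma>) (blinfun_apply \<alpha>)) x
  + bracket \<pi> (blinfun_apply \<gamma>) (bracket \<pi> (blinfun_apply \<alpha>) (blinfun_apply \<beta>)) x"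
  by (subst jacobi_sum_eq_jacobiator) (simp_all add: smooth_on_blinfun_apply differential_blinfun_apply)

lemma jacobiator_cyclic: "jacobiator \<pi> x \<alpha> \<beta> \<gamma> = jacobiator \<pi> x \<beta> \<gamma> \<alpha>"
  by (simp add: jacobiator_def)

text \<open>The covector enters once through the direction of differentiation and twice as a fixed
  argument of \<pi>, each time linearly. With \<open>jacobiator_cyclic\<close> this gives linearity
  in all three slots.\<close>

lemma linear_jacobiator: "linear (\<lambda>\<alpha>. jacobiator \<pi> x \<alpha> \<beta> \<gamma>)"
proof -
  have lin: "linear (\<lambda>\<alpha>. frechet_derivative (P \<alpha>) (at x) v)"
    if P: "\<And>y. linear (\<lambda>\<alpha>. P \<alpha> y)" and d: "\<And>\<alpha>. P \<alpha> differentiable (at x)"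
    for P :: "('a \<Rightarrow>\<^sub>L real) \<Rightarrow> 'a \<Rightarrow> real" and v
  proof (rule linearI)
    fix \<alpha> \<beta> and c :: real
    have "P (\<alpha> + \<beta>) = (\<lambda>y. P \<alpha> y + P \<beta> y)" "P (c *\<^sub>R \<alpha>) = (\<lambda>y. c * P \<alpha> y)"
      by (auto simp: linear_add[OF P] linear_cmul[OF P])
    then show "frechet_derivative (P (\<alpha> + \<beta>)) (at x) v
        = frechet_derivative (P \<alpha>) (at x) v + frechet_derivative (P \<beta>) (at x) v"
      "frechet_derivative (P (c *\<^sub>R \<alpha>)) (at x) v = c *\<^sub>R frechet_derivative (P \<alpha>) (at x) v"
      using frechet_derivative_eq[OF has_derivative_add[OF d[of \<alpha>, unfolded frechet_derivative_works]
            d[of \<beta>, unfolded frechet_derivative_works]]]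
        frechet_derivative_eq[OF has_derivative_mult_right[OF d[of \<alpha>, unfolded frechet_derivative_works], of c]]
      by simp_all
  qed
  have "linear (\<lambda>\<alpha>. half_jacobiator \<pi> x \<alpha> \<beta> \<gamma>)"
    unfolding half_jacobiator_def
    using linear_compose[OF linear_sharp[OF bivector_field_bilinear]
        linear_frechet_derivative[OF bivector_field_differentiable]]
    by (simp add: o_def)
  moreover have "linear (\<lambda>\<alpha>. half_jacobiator \<pi> x \<beta> \<gamma> \<alpha>)"
    unfolding half_jacobiator_def
    by (intro lin bounded_bilinear_linear_right bivector_field_bilinear bivector_field_differentiable)
  moreover have "linear (\<lambda>\<alpha>. half_jacobiator \<pi> x \<gamma> \<alpha> \<beta>)"
    unfolding half_jacobiator_def
    by (intro lin bounded_bilinear_linear_left bivector_field_bilinear bivector_field_differentiable)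
  ultimately show ?thesis
    unfolding jacobiator_def by (intro linear_compose_add)
qed

lemma poisson_structure_iff_jacobiator:
  "poisson_structure \<pi> \<longleftrightarrow> (\<forall>x \<alpha> \<beta> \<gamma>. jacobiator \<pi> x \<alpha> \<beta> \<gamma> = 0)"
proof
  assume "poisson_structure \<pi>"
  then show "\<forall>x \<alpha> \<beta> \<gamma>. jacobiator \<pi> x \<alpha> \<beta> \<gamma> = 0"
    by (simp add: jacobiator_eq_jacobi_sum_linear poisson_structure_def smooth_on_blinfun_apply)
next
  assume "\<forall>x \<alpha> \<beta> \<gamma>. jacobiator \<pi> x \<alpha> \<beta> \<gamma> = 0"
  then show "poisson_structure \<pi>"
    by (simp add: poisson_structure_def \<pi> jacobi_sum_eq_jacobiator)
qed

lemma poisson_structure_coordinatesI: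
  assumes jac: "\<And>a b c x. a \<in> Basis \<Longrightarrow> b \<in> Basis \<Longrightarrow> c \<in> Basis \<Longrightarrow>
      bracket \<pi> ((\<bullet>) a) (bracket \<pi> ((\<bullet>) b) ((\<bullet>) c)) x
    + bracket \<pi> ((\<bullet>) b) (bracket \<pi> ((\<bullet>) c) ((\<bullet>) a)) x
    + bracket \<pi> ((\<bullet>) c) (bracket \<pi> ((\<bullet>) a) ((\<bullet>) b)) x = 0"
  shows "poisson_structure \<pi>"
proof -
  let ?e = "blinfun_inner_right :: 'a \<Rightarrow> 'a \<Rightarrow>\<^sub>L real"
  let ?J = "jacobiator \<pi>"
  have basis: "(\<lambda>\<alpha>. ?J x \<alpha> \<beta> \<gamma>) = (\<lambda>_. 0)" if "\<And>a. a \<in> Basis \<Longrightarrow> ?J x (?e a) \<beta> \<gamma> = 0" for x \<beta> \<gamma>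
    using that by (intro linear_covector_eqI linear_jacobiator linear_zero)
  have "?J x (?e a) (?e b) (?e c) = 0" if "a \<in> Basis" "b \<in> Basis" "c \<in> Basis" for x a b c
    using jac[OF that] by (simp add: jacobiator_eq_jacobi_sum_linear blinfun_inner_right.rep_eq)
  \<comment> \<open>Linearity is at hand in the first slot only, so each round frees one argument
    from the basis and then rotates the next one into first position.\<close>
  then have "?J x \<alpha> (?e b) (?e c) = 0" if "b \<in> Basis" "c \<in> Basis" for x \<alpha> b c
    using basis[of x "?e b" "?e c"] that by meson
  then have "?J x (?e b) (?e c) \<alpha> = 0" if "b \<in> Basis" "c \<in> Basis" for x \<alpha> b c
    using that jacobiator_cyclic by metis
  then have "?J x \<beta> (?e c) \<alpha> = 0" if "c \<in> Basis" for x \<alpha> \<beta> c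
    using basis[of x "?e c" \<alpha>] that by meson
  then have "?J x (?e c) \<alpha> \<beta> = 0" if "c \<in> Basis" for x \<alpha> \<beta> c
    using that jacobiator_cyclic by metis
  then have "?J x \<gamma> \<alpha> \<beta> = 0" for x \<alpha> \<beta> \<gamma>
    using basis[of x \<alpha> \<beta>] by meson
  then show ?thesis by (simp add: poisson_structure_iff_jacobiator)
qed

end

section \<open>The symplectic form on the non-degeneracy locus\<close>

lemma covector_riesz: "(\<Sum>b\<in>Basis. blinfun_apply \<alpha> b *\<^sub>R b) \<bullet> v = blinfun_apply \<alpha> v"
  for v :: "'a::euclidean_space"
  by (subst (2) covector_expansion)
    (simp add: inner_sum_left blinfun.sum_left blinfun.scaleR_left blinfun_inner_right.rep_eq)

lemma blinfun_inner_right_riesz: "blinfun_inner_right (\<Sum>b\<in>Basis. blinfun_apply \<alpha> b *\<^sub>R b) = \<alpha>"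
  for \<alpha> :: "'a::euclidean_space \<Rightarrow>\<^sub>L real"
  by (rule blinfun_eqI) (simp only: blinfun_inner_right.rep_eq covector_riesz)

lemma linear_blinfun_inner_right: "linear (blinfun_inner_right :: 'a::real_inner \<Rightarrow> _)"
  by (simp add: bounded_linear.linear bounded_linear_blinfun_inner_right)

lemma blinfun_inner_right_eq_0_iff: "blinfun_inner_right v = 0 \<longleftrightarrow> v = 0"
  by (metis blinfun_inner_right.rep_eq inner_eq_zero_iff linear_0 linear_blinfun_inner_right
      zero_blinfun.rep_eq)

context
  fixes P :: "('a::euclidean_space) bivec"
  assumes bilinear: "bounded_bilinear P"
begin

lemma sharp_eq_0_iff: "sharp P \<alpha> = 0 \<longleftrightarrow> (\<forall>\<beta>. P \<alpha> \<beta> = 0)"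
proof
  assume "sharp P \<alpha> = 0"
  then show "\<forall>\<beta>. P \<alpha> \<beta> = 0"
    using blinfun_apply_sharp[OF bilinear, of _ \<alpha>] by (simp add: blinfun.zero_right)
qed (simp add: sharp_def)

lemma nondegenerate_iff_sharp: "nondegenerate P \<longleftrightarrow> (\<forall>\<alpha>. sharp P \<alpha> = 0 \<longrightarrow> \<alpha> = 0)"
  unfolding nondegenerate_def sharp_eq_0_iff ..

text \<open>Non-degeneracy supplies the uniqueness that the definite description in
  \<open>flat\<close> demands. The description is opened only here; afterwards \<open>flat\<close>
  is handled as the inverse of \<open>sharp\<close>.\<close>

lemma flat_eqI:
  assumes nd: "nondegenerate P" and "sharp P \<alpha> = u"
  shows "flat P u = \<alpha>"
  unfolding flat_def
proof (rule the_equality)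
  show "\<forall>\<beta>. blinfun_apply \<beta> u = P \<alpha> \<beta>"
    using assms(2) by (auto simp: blinfun_apply_sharp[OF bilinear])
next
  fix \<alpha>' assume "\<forall>\<beta>. blinfun_apply \<beta> u = P \<alpha>' \<beta>"
  then have "\<forall>\<beta>. P (\<alpha>' - \<alpha>) \<beta> = 0"
    using assms(2) by (auto simp: bounded_bilinear.diff_left[OF bilinear] blinfun_apply_sharp[OF bilinear])
  with nd show "\<alpha>' = \<alpha>" unfolding nondegenerate_def by force
qed

context
  assumes nd: "nondegenerate P"
begin

lemma flat_sharp: "flat P (sharp P \<alpha>) = \<alpha>"
  using flat_eqI[OF nd] by blast

text \<open>Composed with the inner-product identification, \<open>sharp\<close> becomes an
  injective endomorphism of a finite-dimensional space, hence surjective; so every u has a covector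
  to which \<open>flat\<close> can return it.\<close>

lemma sharp_flat: "sharp P (flat P u) = u"
proof -
  let ?A = "\<lambda>w. sharp P (blinfun_inner_right w)"
  have "linear ?A"
    using linear_compose[OF linear_blinfun_inner_right linear_sharp[OF bilinear]] by (simp add: o_def)
  moreover have "inj ?A"
    using nd unfolding linear_injective_0[OF \<open>linear ?A\<close>] nondegenerate_iff_sharp
    by (auto simp: blinfun_inner_right_eq_0_iff)
  ultimately obtain w where "?A w = u"
    using linear_injective_imp_surjective by (metis surjD)
  then show ?thesis using flat_sharp by metis
qed

lemma linear_flat: "linear (flat P)"
  by (intro linearI flat_eqI nd)
    (simp_all add: linear_add[OF linear_sharp[OF bilinear]] linear_cmul[OF linear_sharp[OF bilinear]] sharp_flat)

lemma bivec_flat_left: "P (flat P u) \<beta> = blinfun_apply \<beta> u"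
  by (simp add: blinfun_apply_sharp[OF bilinear, symmetric] sharp_flat)

end

end

context
  fixes \<pi> :: "'a::euclidean_space \<Rightarrow> 'a bivec"
  assumes \<pi>: "bivector_field \<pi>"
begin

section \<open>Openness, smoothness and closedness on the locus\<close>

lemma symplectic_form_eq:
  "x \<in> nondegeneracy_locus \<pi> \<Longrightarrow> symplectic_form \<pi> x u v = blinfun_apply (flat (\<pi> x) v) u"
  by (simp add: symplectic_form_def bivec_flat_left bivector_field_bilinear[OF \<pi>] nondegeneracy_locus_def)

lemma symplectic_form_antisym: "symplectic_form \<pi> x u v = - symplectic_form \<pi> x v u"
  unfolding symplectic_form_def by (rule bivector_field_antisym[OF \<pi>])

text \<open>The dependence on the point and on the covector becomes explicit here, with coefficients
  of \<pi> as the only functions of x; continuity and differentiation of \<open>sharp\<close> are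
  read off from it.\<close>

lemma sharp_inner_right_expansion:
  "sharp (\<pi> x) (blinfun_inner_right w) =
    (\<Sum>b\<in>Basis. (\<Sum>a\<in>Basis. (w \<bullet> a) * \<pi> x (blinfun_inner_right a) (blinfun_inner_right b)) *\<^sub>R b)"
  unfolding sharp_def
  by (subst bivec_expansion[OF bivector_field_bilinear[OF \<pi>]])
    (simp add: blinfun_inner_right.rep_eq inner_Basis if_distrib[of "\<lambda>c. _ * c"] if_distrib[of "\<lambda>c. c * _"] cong: if_cong)

text \<open>By homogeneity, degeneracy at x means that some covector of unit length is killed there.
  The degenerate points are thus the projection, along the compact unit sphere, of a closed set of
  pairs, and such a projection is closed.\<close>

lemma open_nondegeneracy_locus: "open (nondegeneracy_locus \<pi>)"
proof -
  let ?A = "\<lambda>x w. sharp (\<pi> x) (blinfun_inner_right w)"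
  have scale: "?A x (c *\<^sub>R w) = c *\<^sub>R ?A x w" for x c w
    by (simp add: linear_cmul[OF linear_blinfun_inner_right]
        linear_cmul[OF linear_sharp[OF bivector_field_bilinear[OF \<pi>]]])
  have cont: "continuous_on UNIV (\<lambda>x. \<pi> x \<alpha> \<beta>)" for \<alpha> \<beta>
    by (rule smooth_on_continuous_on[OF bivector_field_smooth[OF \<pi>]])
  have "continuous_on UNIV (\<lambda>z. ?A (snd z) (fst z))"
    unfolding sharp_inner_right_expansion
    by (intro continuous_intros continuous_on_compose2[OF cont]) auto
  then have "closed {z. ?A (snd z) (fst z) = 0}"
    by (intro closed_Collect_eq) (auto intro: continuous_intros)
  from closed_compact_projection[OF compact_sphere[of 0 1] this]
  have "closed {x. \<exists>w. w \<in> sphere 0 1 \<and> ?A x w = 0}" by simp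
  moreover have "- nondegeneracy_locus \<pi> = {x. \<exists>w. w \<in> sphere 0 1 \<and> ?A x w = 0}"
  proof (intro equalityI subsetI)
    fix x assume "x \<in> - nondegeneracy_locus \<pi>"
    then obtain \<alpha> where \<alpha>: "\<alpha> \<noteq> 0" "sharp (\<pi> x) \<alpha> = 0"
      by (auto simp: nondegeneracy_locus_def nondegenerate_iff_sharp[OF bivector_field_bilinear[OF \<pi>]])
    obtain w where w: "\<alpha> = blinfun_inner_right w"
      using blinfun_inner_right_riesz by metis
    with \<alpha> have "w \<noteq> 0" by (auto simp: blinfun_inner_right_eq_0_iff)
    then have "(1 / norm w) *\<^sub>R w \<in> sphere 0 1 \<and> ?A x ((1 / norm w) *\<^sub>R w) = 0"
      using \<alpha> w by (simp add: scale)
    then show "x \<in> {x. \<exists>w. w \<in> sphere 0 1 \<and> ?A x w = 0}" by blast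
  next
    fix x assume "x \<in> {x. \<exists>w. w \<in> sphere 0 1 \<and> ?A x w = 0}"
    then obtain w where "norm w = 1" "?A x w = 0" by auto
    then show "x \<in> - nondegeneracy_locus \<pi>"
      by (auto simp: nondegeneracy_locus_def nondegenerate_iff_sharp[OF bivector_field_bilinear[OF \<pi>]]
          blinfun_inner_right_eq_0_iff intro!: exI[of _ "blinfun_inner_right w"])
  qed
  ultimately show ?thesis by (simp add: open_closed)
qed

text \<open>The derivative of the inverse is obtained by applying the inverse function theorem to
  \<open>(y, w) \<mapsto> (y, \<pi> y w)\<close>; the formula is then \<open>d(\<pi>\<^sup>-\<^sup>1) = - \<pi>\<^sup>-\<^sup>1 (d\<pi>) \<pi>\<^sup>-\<^sup>1\<close>.\<close>

lemma has_derivative_symplectic_form: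
  assumes x: "x \<in> nondegeneracy_locus \<pi>"
  shows "((\<lambda>y. symplectic_form \<pi> y u v) has_derivative
    frechet_derivative (\<lambda>y. \<pi> y (flat (\<pi> x) v) (flat (\<pi> x) u)) (at x)) (at x)"
proof -
  let ?U = "nondegeneracy_locus \<pi>"
  let ?e = "blinfun_inner_right :: 'a \<Rightarrow> 'a \<Rightarrow>\<^sub>L real"
  let ?DP = "\<lambda>\<alpha> \<beta>. frechet_derivative (\<lambda>y. \<pi> y \<alpha> \<beta>) (at x)"
  note bil = bivector_field_bilinear[OF \<pi>]
  \<comment> \<open>Covectors are represented by vectors through the inner product. So
    \<open>A y\<close> and \<open>W y\<close> are mutually inverse endomorphisms for y in the locus,
    and F and G below act on a single Euclidean space.\<close>
  define A where "A y w = sharp (\<pi> y) (?e w)" for y w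
  define W where "W y v = (\<Sum>b\<in>Basis. blinfun_apply (flat (\<pi> y) v) b *\<^sub>R b)" for y v
  have WA: "W y (A y w) = w" if "y \<in> ?U" for y w
    using that by (simp add: W_def A_def nondegeneracy_locus_def flat_sharp[OF bil] blinfun_inner_right.rep_eq
        euclidean_representation)
  have AW: "A y (W y v) = v" if "y \<in> ?U" for y v
    using that by (simp add: W_def A_def nondegeneracy_locus_def blinfun_inner_right_riesz sharp_flat[OF bil])
  have W_inner: "W y v \<bullet> u = symplectic_form \<pi> y u v" if "y \<in> ?U" for y u v
    using that by (simp add: W_def covector_riesz symplectic_form_eq)
  define w where "w = W x v"
  have ew: "?e w = flat (\<pi> x) v"
    by (simp add: w_def W_def blinfun_inner_right_riesz)
  \<comment> \<open>The derivative at x of \<open>A y w\<close> with respect to y, with w held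
    fixed.\<close>
  define DA where "DA h = (\<Sum>b\<in>Basis. ?DP (?e w) (?e b) h *\<^sub>R b)" for h
  define F where "F z = (fst z, A (fst z) (snd z))" for z
  define G where "G z = (fst z, W (fst z) (snd z))" for z
  have DA': "DA h = (\<Sum>b\<in>Basis. (\<Sum>a\<in>Basis. (w \<bullet> a) * ?DP (?e a) (?e b) h) *\<^sub>R b)" for h
    unfolding DA_def
    by (subst frechet_derivative_bivector_field[OF \<pi>])
      (simp add: blinfun_inner_right.rep_eq inner_Basis if_distrib[of "\<lambda>c. _ * c"] if_distrib[of "\<lambda>c. c * _"] cong: if_cong)
  have dP: "((\<lambda>z. \<pi> (fst z) \<alpha> \<beta>) has_derivative (\<lambda>k. ?DP \<alpha> \<beta> (fst k))) (at (x, w))" for \<alpha> \<beta>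
    using diff_chain_at[OF bounded_linear_imp_has_derivative[OF bounded_linear_fst], of "\<lambda>y. \<pi> y \<alpha> \<beta>" "?DP \<alpha> \<beta>" "(x, w)"]
      bivector_field_differentiable[OF \<pi>, of \<alpha> \<beta> x]
    by (simp add: o_def frechet_derivative_works)
  have derF: "(F has_derivative (\<lambda>k. (fst k, DA (fst k) + A x (snd k)))) (at (x, w))"
  proof -
    have "((\<lambda>z. (fst z, \<Sum>b\<in>Basis. (\<Sum>a\<in>Basis. (snd z \<bullet> a) * \<pi> (fst z) (?e a) (?e b)) *\<^sub>R b))
      has_derivative (\<lambda>k. (fst k, \<Sum>b\<in>Basis. (\<Sum>a\<in>Basis.
        (w \<bullet> a) * ?DP (?e a) (?e b) (fst k) + (snd k \<bullet> a) * \<pi> x (?e a) (?e b)) *\<^sub>R b))) (at (x, w))"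
      by (auto intro!: derivative_eq_intros dP)
    moreover have "F = (\<lambda>z. (fst z, \<Sum>b\<in>Basis. (\<Sum>a\<in>Basis. (snd z \<bullet> a) * \<pi> (fst z) (?e a) (?e b)) *\<^sub>R b))"
      by (simp add: fun_eq_iff F_def A_def sharp_inner_right_expansion)
    moreover have "(\<lambda>k. (fst k, DA (fst k) + A x (snd k))) =
      (\<lambda>k. (fst k, \<Sum>b\<in>Basis. (\<Sum>a\<in>Basis.
        (w \<bullet> a) * ?DP (?e a) (?e b) (fst k) + (snd k \<bullet> a) * \<pi> x (?e a) (?e b)) *\<^sub>R b))"
      by (simp add: fun_eq_iff DA' A_def sharp_inner_right_expansion sum.distrib scaleR_left_distrib)
    ultimately show ?thesis by simp
  qed
  have contF: "continuous_on (?U \<times> UNIV) F"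
  proof -
    have cont: "continuous_on UNIV (\<lambda>x. \<pi> x \<alpha> \<beta>)" for \<alpha> \<beta>
      by (rule smooth_on_continuous_on[OF bivector_field_smooth[OF \<pi>]])
    show ?thesis
      unfolding F_def A_def sharp_inner_right_expansion
      by (intro continuous_intros continuous_on_compose2[OF cont]) auto
  qed
  \<comment> \<open>The derivative of F is block-triangular with identity on the base. Solving
    \<open>DA h + A x k = l\<close> for k needs only the inverse \<open>W x\<close> of the fibre
    block.\<close>
  have inv: "(\<lambda>k. (fst k, DA (fst k) + A x (snd k))) \<circ> (\<lambda>k. (fst k, W x (snd k - DA (fst k)))) = id"
    by (auto simp: fun_eq_iff AW x)
  have "(G has_derivative (\<lambda>k. (fst k, W x (snd k - DA (fst k))))) (at (F (x, w)))"
  proof (rule has_derivative_inverse_strong[OF _ _ contF _ derF inv])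
    show "open (?U \<times> (UNIV :: 'a set))"
      by (intro open_Times open_nondegeneracy_locus open_UNIV)
    show "(x, w) \<in> ?U \<times> UNIV" using x by simp
    show "G (F z) = z" if "z \<in> ?U \<times> UNIV" for z
      using that by (auto simp: F_def G_def WA)
  qed
  moreover have "F (x, w) = (x, v)"
    by (simp add: F_def w_def AW x)
  ultimately have "(G has_derivative (\<lambda>k. (fst k, W x (snd k - DA (fst k))))) (at (x, v))"
    by simp
  moreover have "((\<lambda>y. (y, v)) has_derivative (\<lambda>h. (h, 0))) (at x)"
    by (auto intro!: derivative_eq_intros)
  ultimately have "(G \<circ> (\<lambda>y. (y, v)) has_derivative
      (\<lambda>k. (fst k, W x (snd k - DA (fst k)))) \<circ> (\<lambda>h. (h, 0))) (at x)"
    by (intro diff_chain_at)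
  then have "((\<lambda>y. (y, W y v)) has_derivative (\<lambda>h. (h, W x (- DA h)))) (at x)"
    by (simp add: o_def G_def)
  then have "((\<lambda>y. W y v \<bullet> u) has_derivative (\<lambda>h. W x (- DA h) \<bullet> u)) (at x)"
    using has_derivative_inner_left[OF has_derivative_snd] by fastforce
  moreover have "W x (- DA h) \<bullet> u = ?DP (flat (\<pi> x) v) (flat (\<pi> x) u) h" for h
  proof -
    \<comment> \<open>Skew-symmetry lets the covector of u act on \<open>DA h\<close> in place of
      inverting there. Its sign cancels the minus sign of the derivative of an inverse, which leaves
      v before u in the result.\<close>
    have "W x (- DA h) \<bullet> u = - blinfun_apply (flat (\<pi> x) u) (- DA h)"
      using W_inner[OF x] symplectic_form_antisym symplectic_form_eq[OF x] by metis
    also have "\<dots> = (\<Sum>b\<in>Basis. ?DP (?e w) (?e b) h * blinfun_apply (flat (\<pi> x) u) b)"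
      by (simp add: DA_def blinfun.minus_right blinfun.sum_right blinfun.scaleR_right)
    also have "\<dots> = ?DP (?e w) (flat (\<pi> x) u) h"
    proof -
      define R where "R b = (\<Sum>a\<in>Basis. (w \<bullet> a) * ?DP (?e a) (?e b) h)" for b
      have R: "?DP (?e w) \<beta> h = (\<Sum>b\<in>Basis. blinfun_apply \<beta> b * R b)" for \<beta>
        unfolding R_def
        by (subst frechet_derivative_bivector_field[OF \<pi>], subst sum.swap)
          (simp add: blinfun_inner_right.rep_eq sum_distrib_left mult_ac)
      have "?DP (?e w) (?e b) h = R b" if "b \<in> Basis" for b
        using that by (simp add: R blinfun_inner_right.rep_eq inner_Basis
          if_distrib[of "\<lambda>c. c * _"] cong: if_cong)
      then show ?thesis
        by (simp add: R[of "flat (\<pi> x) u"] mult.commute cong: sum.cong)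
    qed
    finally show ?thesis by (simp add: ew)
  qed
  ultimately have "((\<lambda>y. W y v \<bullet> u) has_derivative ?DP (flat (\<pi> x) v) (flat (\<pi> x) u)) (at x)"
    by simp
  then show ?thesis
    by (rule has_derivative_transform_within_open[OF _ open_nondegeneracy_locus x]) (simp add: W_inner)
qed

text \<open>A bootstrap: the derivative of \<omega> is a polynomial in values of \<omega> and in
  first derivatives of the smooth field \<pi>. Hence if all \<omega>(u, v) are C^k, their
  derivatives are C^k too, and they are C^(k+1).\<close>

lemma smooth_on_symplectic_form:
  "smooth_on (nondegeneracy_locus \<pi>) (\<lambda>x. symplectic_form \<pi> x u v)"
proof -
  let ?U = "nondegeneracy_locus \<pi>"
  let ?e = "blinfun_inner_right :: 'a \<Rightarrow> 'a \<Rightarrow>\<^sub>L real"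
  note U = open_nondegeneracy_locus
  have diff: "(\<lambda>x. symplectic_form \<pi> x u v) differentiable (at x)" if "x \<in> ?U" for x u v
    using has_derivative_symplectic_form[OF that] by (rule differentiableI)
  have deriv: "frechet_derivative (\<lambda>x. symplectic_form \<pi> x u v) (at x) h =
    (\<Sum>a\<in>Basis. \<Sum>b\<in>Basis. symplectic_form \<pi> x a v * symplectic_form \<pi> x b u *
      frechet_derivative (\<lambda>y. \<pi> y (?e a) (?e b)) (at x) h)" if "x \<in> ?U" for x u v h
    unfolding frechet_derivative_eq[OF has_derivative_symplectic_form[OF that]]
    by (subst frechet_derivative_bivector_field[OF \<pi>]) (simp add: symplectic_form_eq[OF that])
  have "C_diff_on k ?U (\<lambda>x. symplectic_form \<pi> x u v)" for k u v
  proof (induction k arbitrary: u v)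
    case 0
    then show ?case
      by (auto intro!: continuous_at_imp_continuous_on differentiable_imp_continuous_within diff)
  next
    case (Suc k)
    have D: "C_diff_on k ?U (\<lambda>x. frechet_derivative (\<lambda>y. \<pi> y \<alpha> \<beta>) (at x) h)" for \<alpha> \<beta> h
      by (rule C_diff_on_subset[OF _ subset_UNIV])
        (use smooth_on_frechet_derivative[OF bivector_field_smooth[OF \<pi>]] in \<open>simp add: smooth_on_def\<close>)
    have "C_diff_on k ?U (\<lambda>x. frechet_derivative (\<lambda>x. symplectic_form \<pi> x u v) (at x) h)" for h
      by (subst C_diff_on_cong[OF U deriv], assumption)
        (intro C_diff_on_sum C_diff_on_mult U Suc.IH D)
    then show ?case by (simp add: diff)
  qed
  then show ?thesis by (simp add: smooth_on_def)
qed

lemma symplectic_on_nondegeneracy_locus: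
  assumes "poisson_structure \<pi>"
  shows "symplectic_on (nondegeneracy_locus \<pi>) (symplectic_form \<pi>)"
  unfolding symplectic_on_def
proof (intro conjI ballI allI impI)
  let ?U = "nondegeneracy_locus \<pi>"
  show "open ?U" by (rule open_nondegeneracy_locus)
  show "smooth_on ?U (\<lambda>x. symplectic_form \<pi> x u v)" for u v by (rule smooth_on_symplectic_form)
  fix x assume x: "x \<in> ?U"
  then have nd: "nondegenerate (\<pi> x)" by (simp add: nondegeneracy_locus_def)
  note bil = bivector_field_bilinear[OF \<pi>, of x]
  note lin = linear_flat[OF bil nd]
  show "bounded_bilinear (symplectic_form \<pi> x)"
    unfolding bilinear_conv_bounded_bilinear[symmetric] bilinear_def
    using linear_compose[OF lin bounded_bilinear_linear_right[OF bil]]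
      linear_compose[OF lin bounded_bilinear_linear_left[OF bil]]
    by (simp add: symplectic_form_def[abs_def] o_def)
  show "symplectic_form \<pi> x u u = 0" for u
    by (simp add: symplectic_form_def bivector_field_alternating[OF \<pi>])
  show "u = 0" if "\<forall>v. symplectic_form \<pi> x u v = 0" for u
  proof -
    \<comment> \<open>This test vector corresponds to the covector given by the inner product with
      u, so the hypothesis becomes u \<bullet> u = 0.\<close>
    have "symplectic_form \<pi> x u (sharp (\<pi> x) (blinfun_inner_right u)) = 0"
      using that by blast
    then show ?thesis
      by (simp add: symplectic_form_eq[OF x] flat_sharp[OF bil nd] blinfun_inner_right.rep_eq)
  qed
  fix u v w
  \<comment> \<open>The derivative formula exchanges v and w, and u is the \<open>sharp\<close> of
    its own \<open>flat\<close>. The three terms of the exterior derivative are therefore the three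
    cyclic terms of the Jacobiator at u, w, v.\<close>
  have half: "frechet_derivative (\<lambda>y. symplectic_form \<pi> y v w) (at x) u =
    half_jacobiator \<pi> x (flat (\<pi> x) u) (flat (\<pi> x) w) (flat (\<pi> x) v)" for u v w
    by (simp add: frechet_derivative_eq[OF has_derivative_symplectic_form[OF x]]
        half_jacobiator_def sharp_flat[OF bil nd])
  have "jacobiator \<pi> x (flat (\<pi> x) u) (flat (\<pi> x) w) (flat (\<pi> x) v) = 0"
    using assms poisson_structure_iff_jacobiator[OF \<pi>] by blast
  then show "frechet_derivative (\<lambda>y. symplectic_form \<pi> y v w) (at x) u
      + frechet_derivative (\<lambda>y. symplectic_form \<pi> y w u) (at x) v
      + frechet_derivative (\<lambda>y. symplectic_form \<pi> y u v) (at x) w = 0"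
    by (simp add: half jacobiator_def)
qed

end

section \<open>Bi-vectors in coordinates\<close>

lemma bounded_bilinear_add:
  assumes "bounded_bilinear f" "bounded_bilinear g"
  shows "bounded_bilinear (\<lambda>x y. f x y + g x y)"
proof -
  obtain K where K: "\<And>a b. norm (f a b) \<le> norm a * norm b * K"
    using bounded_bilinear.bounded[OF assms(1)] by blast
  obtain L where L: "\<And>a b. norm (g a b) \<le> norm a * norm b * L"
    using bounded_bilinear.bounded[OF assms(2)] by blast
  have "norm (f a b + g a b) \<le> norm a * norm b * (K + L)" for a b
    using norm_triangle_mono[OF K[of a b] L[of a b]] by (simp add: distrib_left)
  then show ?thesis
    by unfold_locales
      (auto simp: bounded_bilinear.add_left[OF assms(1)] bounded_bilinear.add_left[OF assms(2)]
        bounded_bilinear.add_right[OF assms(1)] bounded_bilinear.add_right[OF assms(2)]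
        bounded_bilinear.scaleR_left[OF assms(1)] bounded_bilinear.scaleR_left[OF assms(2)]
        bounded_bilinear.scaleR_right[OF assms(1)] bounded_bilinear.scaleR_right[OF assms(2)]
        scaleR_right_distrib)
qed

lemma bounded_bilinear_zero: "bounded_bilinear (\<lambda>x y. 0)"
  by unfold_locales (auto intro: exI[of _ 0])

lemma bounded_bilinear_sum:
  assumes "\<And>i. i \<in> I \<Longrightarrow> bounded_bilinear (f i)"
  shows "bounded_bilinear (\<lambda>x y. \<Sum>i\<in>I. f i x y)"
  using assms
  by (induction I rule: infinite_finite_induct) (auto intro: bounded_bilinear_zero bounded_bilinear_add)

lemma bounded_bilinear_wedge: "bounded_bilinear (\<lambda>\<alpha> \<beta>. c * wedge u v \<alpha> \<beta>)"
proof -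
  have *: "bounded_bilinear (\<lambda>(\<alpha> :: 'a \<Rightarrow>\<^sub>L real) \<beta>. (d * blinfun_apply \<alpha> u) * blinfun_apply \<beta> v)" for d u v
    by (intro bounded_bilinear.comp[OF bounded_bilinear_mult] bounded_linear_const_mult
        blinfun.bounded_linear_left)
  have "(\<lambda>\<alpha> \<beta>. c * wedge u v \<alpha> \<beta>) = (\<lambda>\<alpha> \<beta>. (c * blinfun_apply \<alpha> u) * blinfun_apply \<beta> v
      + (- c * blinfun_apply \<alpha> v) * blinfun_apply \<beta> u)"
    by (simp add: wedge_def fun_eq_iff algebra_simps)
  then show ?thesis using bounded_bilinear_add[OF *[of c u v] *[of "- c" v u]] by simp
qed

lemma wedge_self: "wedge u v \<alpha> \<alpha> = 0"
  by (simp add: wedge_def)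

lemma bivec_eqI:
  fixes P Q :: "'a::euclidean_space bivec"
  assumes "bounded_bilinear P" "bounded_bilinear Q"
    and "\<And>a b. a \<in> Basis \<Longrightarrow> b \<in> Basis \<Longrightarrow>
      P (blinfun_inner_right a) (blinfun_inner_right b) = Q (blinfun_inner_right a) (blinfun_inner_right b)"
  shows "P = Q"
proof (intro ext)
  fix \<alpha> \<beta>
  show "P \<alpha> \<beta> = Q \<alpha> \<beta>"
    by (subst bivec_expansion[OF assms(1)], subst bivec_expansion[OF assms(2)])
      (simp add: assms(3) cong: sum.cong)
qed

lemma bracket_inner: "bracket \<pi> ((\<bullet>) a) ((\<bullet>) b) x = \<pi> x (blinfun_inner_right a) (blinfun_inner_right b)"
  using differential_blinfun_apply[of "blinfun_inner_right a" x]
    differential_blinfun_apply[of "blinfun_inner_right b" x]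
  by (simp add: bracket_def blinfun_inner_right.rep_eq)

lemma sharp_eqI:
  assumes "\<And>\<beta>. P \<alpha> \<beta> = blinfun_apply \<beta> u"
  shows "sharp P \<alpha> = u"
  by (simp add: sharp_def assms blinfun_inner_right.rep_eq inner_commute[of _ u] euclidean_representation)

section \<open>Jacobi identities for coordinate functions\<close>

text \<open>Packaged as one function of three arguments so that its cyclic and skew symmetries can
  reduce the triples of coordinates to a few representatives.\<close>

definition jacobi_sum ::
  "('a::euclidean_space \<Rightarrow> 'a bivec) \<Rightarrow> ('a \<Rightarrow> real) \<Rightarrow> ('a \<Rightarrow> real) \<Rightarrow> ('a \<Rightarrow> real) \<Rightarrow> 'a \<Rightarrow> real" where
  "jacobi_sum \<pi> f g h x =
     bracket \<pi> f (bracket \<pi> g h) x + bracket \<pi> g (bracket \<pi> h f) x + bracket \<pi> h (bracket \<pi> f g) x"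

lemma jacobi_sum_cyclic: "jacobi_sum \<pi> f g h x = jacobi_sum \<pi> g h f x"
  by (simp add: jacobi_sum_def)

context
  fixes \<pi> :: "'a::euclidean_space \<Rightarrow> 'a bivec"
  assumes \<pi>: "bivector_field \<pi>"
begin

lemma jacobi_sum_swap:
  assumes f: "smooth_on UNIV f" and g: "smooth_on UNIV g" and h: "smooth_on UNIV h"
  shows "jacobi_sum \<pi> f g h x = - jacobi_sum \<pi> g f h x"
proof -
  have "bracket \<pi> f (bracket \<pi> g h) x = - bracket \<pi> f (bracket \<pi> h g) x"
    if "smooth_on UNIV g" "smooth_on UNIV h" for f g h
  proof -
    have "bracket \<pi> g h = (\<lambda>x. - 1 * bracket \<pi> h g x)"
      by (simp add: fun_eq_iff bracket_antisym[OF \<pi>, of g h])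
    then show ?thesis
      using bracket_cmult_right[OF \<pi> frechet_derivative_bracket(1)[OF \<pi> that(2,1)], of f "- 1" x]
      by simp
  qed
  from this[OF g h, of f] this[OF h f, of g] this[OF f g, of h]
  show ?thesis by (simp add: jacobi_sum_def)
qed

lemma jacobi_sum_self:
  "smooth_on UNIV f \<Longrightarrow> smooth_on UNIV h \<Longrightarrow> jacobi_sum \<pi> f f h x = 0"
  using jacobi_sum_swap[of f f h x] by simp

text \<open>If all three brackets are log-canonical, then each of the nested brackets is a multiple of \<open>f g h\<close>.\<close>

lemma jacobi_sum_log_canonical:
  assumes "smooth_on UNIV f" "smooth_on UNIV g" "smooth_on UNIV h"
    and fg: "bracket \<pi> f g = (\<lambda>x. a * (f x * g x))"
    and gh: "bracket \<pi> g h = (\<lambda>x. b * (g x * h x))"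
    and hf: "bracket \<pi> h f = (\<lambda>x. c * (h x * f x))"
  shows "jacobi_sum \<pi> f g h x = 0"
proof -
  have d: "f differentiable (at x)" "g differentiable (at x)" "h differentiable (at x)"
    using assms(1-3) by (auto intro: smooth_on_differentiable)
  have "bracket \<pi> g f x = - (a * (f x * g x))" "bracket \<pi> h g x = - (b * (g x * h x))"
    "bracket \<pi> f h x = - (c * (h x * f x))"
    using bracket_antisym[OF \<pi>] fg gh hf by metis+
  then show ?thesis
    unfolding jacobi_sum_def fg gh hf
    using d by (simp add: bracket_cmult_right[OF \<pi>] bracket_mult_right[OF \<pi>] differentiable_mult fg gh hf
        algebra_simps)
qed

end

section \<open>The standard r-matrix\<close>

lemma sgn_diff_antisym: "sgn_diff j k = - sgn_diff k j"
  by (auto simp: sgn_diff_def)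

lemma vec_nth_eq_inner: "(\<lambda>y :: real^'n::finite. y $ j) = (\<bullet>) (axis j 1)"
  by (simp add: fun_eq_iff inner_axis')

lemma smooth_on_vec_nth: "smooth_on U (\<lambda>y :: real^'n::finite. y $ j)"
  by (simp add: smooth_on_bounded_linear bounded_linear_vec_nth)

text \<open>Since e_j^k x = x^k e_j, the wedge of e_j^k x and e_k^j x is x^j x^k times the wedge of
  e_j and e_k: the coefficients are log-canonical.\<close>

lemma standard_r_field_wedge:
  "standard_r_field \<epsilon> x \<alpha> \<beta> =
    (\<Sum>(j, k)\<in>{(j, k). j < k}. (\<epsilon> * (x $ j * x $ k)) * wedge (axis j 1) (axis k 1) \<alpha> \<beta>)"
  unfolding standard_r_field_def fundamental_bivector_field_def
  by (rule sum.cong) (auto simp: scaleR_matrix_vector_assoc[symmetric] matrix_unit_mult_vec wedge_def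
      blinfun.scaleR_right algebra_simps)

lemma bivector_field_standard_r:
  "bivector_field (standard_r_field \<epsilon> :: real^'n::{finite,linorder} \<Rightarrow> _)"
  unfolding bivector_field_def
proof (intro conjI allI)
  fix x :: "real^'n::{finite,linorder}" and \<alpha> \<beta> :: "(real^'n::{finite,linorder}) \<Rightarrow>\<^sub>L real"
  show "bounded_bilinear (standard_r_field \<epsilon> x)"
    unfolding standard_r_field_wedge[abs_def] split_def
    by (intro bounded_bilinear_sum bounded_bilinear_wedge)
  show "standard_r_field \<epsilon> x \<alpha> \<alpha> = 0"
    by (simp add: standard_r_field_wedge wedge_self split_def)
  show "smooth_on UNIV (\<lambda>x. standard_r_field \<epsilon> x \<alpha> \<beta>)"
    unfolding standard_r_field_wedge split_def
    by (intro smooth_on_sum smooth_on_mult smooth_on_const smooth_on_vec_nth open_UNIV)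
qed

lemma bracket_standard_r_less:
  fixes j k :: "'n::{finite,linorder}"
  assumes "j < k"
  shows "bracket (standard_r_field \<epsilon>) (\<lambda>y. y $ j) (\<lambda>y. y $ k) x = \<epsilon> * x $ j * x $ k"
proof -
  have "bracket (standard_r_field \<epsilon>) (\<lambda>y. y $ j) (\<lambda>y. y $ k) x =
    (\<Sum>il\<in>{(i, l). i < l}. if il = (j, k) then \<epsilon> * x $ j * x $ k else 0)"
    unfolding vec_nth_eq_inner bracket_inner standard_r_field_wedge
    using assms
    by (intro sum.cong) (auto simp: wedge_def blinfun_inner_right.rep_eq inner_axis_axis split: if_splits)
  with assms show ?thesis by (simp add: sum.delta)
qed

text \<open>The sign factor absorbs the condition j < k, including the diagonal, so that
  \<open>jacobi_sum_log_canonical\<close> applies to every triple without a case split.\<close>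

lemma bracket_standard_r:
  "bracket (standard_r_field \<epsilon>) (\<lambda>y. y $ j) (\<lambda>y. y $ k) =
    (\<lambda>x. \<epsilon> * sgn_diff k j * (x $ j * x $ k))"
proof
  fix x
  note anti = bracket_antisym[OF bivector_field_standard_r, of \<epsilon> "\<lambda>y. y $ j" "\<lambda>y. y $ k" x]
  show "bracket (standard_r_field \<epsilon>) (\<lambda>y. y $ j) (\<lambda>y. y $ k) x = \<epsilon> * sgn_diff k j * (x $ j * x $ k)"
  proof (cases j k rule: linorder_cases)
    case less
    then show ?thesis by (simp add: bracket_standard_r_less sgn_diff_def)
  next
    case equal
    then show ?thesis by (simp add: bracket_self[OF bivector_field_standard_r] sgn_diff_def)
  next
    case greater
    then show ?thesis unfolding anti by (auto simp: bracket_standard_r_less sgn_diff_def)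
  qed
qed

lemma poisson_structure_standard_r:
  "poisson_structure (standard_r_field \<epsilon> :: real^'n::{finite,linorder} \<Rightarrow> _)"
proof (rule poisson_structure_coordinatesI[OF bivector_field_standard_r])
  fix a b c x :: "real^'n::{finite,linorder}"
  assume "a \<in> Basis" "b \<in> Basis" "c \<in> Basis"
  then obtain i j k where "a = axis i 1" "b = axis j 1" "c = axis k 1"
    by (auto simp: Basis_vec_def)
  then show "bracket (standard_r_field \<epsilon>) ((\<bullet>) a) (bracket (standard_r_field \<epsilon>) ((\<bullet>) b) ((\<bullet>) c)) x +
     bracket (standard_r_field \<epsilon>) ((\<bullet>) b) (bracket (standard_r_field \<epsilon>) ((\<bullet>) c) ((\<bullet>) a)) x +
     bracket (standard_r_field \<epsilon>) ((\<bullet>) c) (bracket (standard_r_field \<epsilon>) ((\<bullet>) a) ((\<bullet>) b)) x = 0"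
    using jacobi_sum_log_canonical[OF bivector_field_standard_r smooth_on_vec_nth smooth_on_vec_nth
        smooth_on_vec_nth bracket_standard_r bracket_standard_r bracket_standard_r, of \<epsilon> i j k x]
    by (simp add: jacobi_sum_def vec_nth_eq_inner)
qed

section \<open>The Poisson structure on the cotangent bundle\<close>

lemma cx_eq_inner: "cx j = (\<bullet>) (axis j 1, 0)"
  and cp_eq_inner: "cp j = (\<bullet>) (0, axis j 1)"
  by (simp_all add: fun_eq_iff cx_def cp_def inner_axis' inner_Pair_0)

lemma smooth_on_cx: "smooth_on U (cx j)" and smooth_on_cp: "smooth_on U (cp j)"
  unfolding cx_eq_inner cp_eq_inner
  by (simp_all add: smooth_on_bounded_linear bounded_linear_inner_right)

lemma differentiable_cx: "cx j differentiable (at z)" and differentiable_cp: "cp j differentiable (at z)"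
  by (rule smooth_on_differentiable[OF smooth_on_cx UNIV_I],
      rule smooth_on_differentiable[OF smooth_on_cp UNIV_I])

lemma Basis_cotangent_cases:
  fixes a :: "(real^'n::finite) \<times> (real^'n)"
  assumes "a \<in> Basis"
  obtains j where "(\<bullet>) a = cx j" "a = (axis j 1, 0)" | j where "(\<bullet>) a = cp j" "a = (0, axis j 1)"
  using assms by (auto simp: Basis_prod_def Basis_vec_def cx_eq_inner cp_eq_inner)

text \<open>What remains of {x^j, p_j} after the log-canonical part \<epsilon> x^j p_j is split
  off.\<close>

definition diagonal_term :: "real \<Rightarrow> 'n::{finite,linorder} \<Rightarrow> (real^'n::{finite,linorder}) \<times> (real^'n::{finite,linorder}) \<Rightarrow> real" where
  "diagonal_term \<epsilon> j z = - 1 + \<epsilon> * (\<Sum>i\<in>UNIV. (1 - sgn_diff i j) * (cx i z * cp i z))"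

text \<open>The factors \<open>1 / 2\<close> are there because each unordered pair \<open>j \<noteq> k\<close> is counted twice.\<close>

definition cotangent_field ::
  "real \<Rightarrow> (real^'n::{finite,linorder}) \<times> (real^'n::{finite,linorder}) \<Rightarrow> ((real^'n::{finite,linorder}) \<times> (real^'n::{finite,linorder})) bivec" where
  "cotangent_field \<epsilon> z \<alpha> \<beta> = (\<Sum>j\<in>UNIV. \<Sum>k\<in>UNIV.
     (\<epsilon> / 2 * sgn_diff k j * (cx j z * cx k z)) * wedge (axis j 1, 0) (axis k 1, 0) \<alpha> \<beta>
   + (- \<epsilon> / 2 * sgn_diff k j * (cp j z * cp k z)) * wedge (0, axis j 1) (0, axis k 1) \<alpha> \<beta>
   + (\<epsilon> * (cx j z * cp k z) + (if j = k then 1 else 0) * diagonal_term \<epsilon> j z)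
       * wedge (axis j 1, 0) (0, axis k 1) \<alpha> \<beta>)"

lemma smooth_on_diagonal_term: "smooth_on UNIV (diagonal_term \<epsilon> j)"
  unfolding diagonal_term_def[abs_def]
  by (intro smooth_on_add smooth_on_sum smooth_on_mult smooth_on_const smooth_on_cx smooth_on_cp open_UNIV)

lemma bivector_field_cotangent: "bivector_field (cotangent_field \<epsilon> :: (real^'n::{finite,linorder}) \<times> _ \<Rightarrow> _)"
  unfolding bivector_field_def
proof (intro conjI allI)
  fix z :: "(real^'n::{finite,linorder}) \<times> (real^'n::{finite,linorder})" and \<alpha> \<beta>
  show "bounded_bilinear (cotangent_field \<epsilon> z)"
    unfolding cotangent_field_def[abs_def]
    by (intro bounded_bilinear_sum bounded_bilinear_add bounded_bilinear_wedge)
  show "cotangent_field \<epsilon> z \<alpha> \<alpha> = 0"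
    by (simp add: cotangent_field_def wedge_self)
  show "smooth_on UNIV (\<lambda>z. cotangent_field \<epsilon> z \<alpha> \<beta>)"
    unfolding cotangent_field_def
    by (intro smooth_on_add smooth_on_sum smooth_on_mult smooth_on_const smooth_on_cx smooth_on_cp
        smooth_on_diagonal_term open_UNIV)
qed

lemma cotangent_brackets_cotangent_field:
  "cotangent_brackets \<epsilon> (cotangent_field \<epsilon> :: (real^'n::{finite,linorder}) \<times> _ \<Rightarrow> _)"
  unfolding cotangent_brackets_def
proof (intro conjI allI impI)
  fix j k :: 'n and z :: "(real^'n::{finite,linorder}) \<times> (real^'n::{finite,linorder})"
  have ax: "axis i (1::real) \<bullet> axis l 1 = (if l = i then 1 else 0)" for i l :: 'n
    by (auto simp: inner_axis_axis)
  have delta: "(\<Sum>i\<in>UNIV. \<Sum>l\<in>UNIV. f i l * ((if i = j then 1 else 0) * (if l = k then 1 else 0))) = f j k"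
    for f :: "'n \<Rightarrow> 'n \<Rightarrow> real" and j k
    by (simp add: if_distrib[of "\<lambda>c. _ * c"] cong: if_cong)
  show "bracket (cotangent_field \<epsilon>) (cx j) (cp k) z =
        - (if j = k then 1 else 0)
        + \<epsilon> * (cx j z * cp k z
               + (if j = k then 1 else 0) * (\<Sum>i\<in>UNIV. (1 - sgn_diff i j) * cx i z * cp i z))"
  proof -
    have "bracket (cotangent_field \<epsilon>) (cx j) (cp k) z =
      (\<Sum>i\<in>UNIV. \<Sum>l\<in>UNIV. (\<epsilon> * (cx i z * cp l z) + (if i = l then 1 else 0) * diagonal_term \<epsilon> i z)
        * ((if i = j then 1 else 0) * (if l = k then 1 else 0)))"
      unfolding cx_eq_inner[of j] cp_eq_inner[of k] bracket_inner cotangent_field_def wedge_def blinfun_inner_right.rep_eq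
      by (simp add: inner_Pair ax)
    then show ?thesis unfolding delta by (simp add: diagonal_term_def algebra_simps)
  qed
  assume jk: "j < k"
  \<comment> \<open>The two double sums pick out the pairs (j, k) and (k, j). As
    \<open>sgn_diff\<close> is antisymmetric, they contribute equally to the difference.\<close>
  have "bracket (cotangent_field \<epsilon>) (cx j) (cx k) z =
      (\<Sum>i\<in>UNIV. \<Sum>l\<in>UNIV. (\<epsilon> / 2 * sgn_diff l i * (cx i z * cx l z)) * ((if i = j then 1 else 0) * (if l = k then 1 else 0)))
    - (\<Sum>i\<in>UNIV. \<Sum>l\<in>UNIV. (\<epsilon> / 2 * sgn_diff l i * (cx i z * cx l z)) * ((if i = k then 1 else 0) * (if l = j then 1 else 0)))"
    unfolding cx_eq_inner[of j] cx_eq_inner[of k] bracket_inner cotangent_field_def wedge_def blinfun_inner_right.rep_eq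
      sum_subtractf[symmetric]
    by (intro sum.cong refl) (simp add: inner_Pair ax)
  then show "bracket (cotangent_field \<epsilon>) (cx j) (cx k) z = \<epsilon> * cx j z * cx k z"
    unfolding delta using jk by (auto simp: sgn_diff_def)
  have "bracket (cotangent_field \<epsilon>) (cp j) (cp k) z =
      (\<Sum>i\<in>UNIV. \<Sum>l\<in>UNIV. (- \<epsilon> / 2 * sgn_diff l i * (cp i z * cp l z)) * ((if i = j then 1 else 0) * (if l = k then 1 else 0)))
    - (\<Sum>i\<in>UNIV. \<Sum>l\<in>UNIV. (- \<epsilon> / 2 * sgn_diff l i * (cp i z * cp l z)) * ((if i = k then 1 else 0) * (if l = j then 1 else 0)))"
    unfolding cp_eq_inner[of j] cp_eq_inner[of k] bracket_inner cotangent_field_def wedge_def blinfun_inner_right.rep_eq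
      sum_subtractf[symmetric]
    by (intro sum.cong refl) (simp add: inner_Pair ax)
  then show "bracket (cotangent_field \<epsilon>) (cp j) (cp k) z = - \<epsilon> * cp j z * cp k z"
    unfolding delta using jk by (auto simp: sgn_diff_def)
qed

section \<open>Consequences of the brackets for any bi-vector field that has them\<close>

context
  fixes \<pi> :: "(real^'n::{finite,linorder}) \<times> (real^'n::{finite,linorder}) \<Rightarrow> ((real^'n::{finite,linorder}) \<times> (real^'n::{finite,linorder})) bivec"
    and \<epsilon> :: real
  assumes \<pi>: "bivector_field \<pi>" and br: "cotangent_brackets \<epsilon> \<pi>"
begin

lemma bracket_cx_cx: "bracket \<pi> (cx j) (cx k) = (\<lambda>z. \<epsilon> * sgn_diff k j * (cx j z * cx k z))"
proof
  fix z
  have less: "bracket \<pi> (cx j) (cx k) z = \<epsilon> * cx j z * cx k z" if "j < k" for j k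
    using br that unfolding cotangent_brackets_def by blast
  show "bracket \<pi> (cx j) (cx k) z = \<epsilon> * sgn_diff k j * (cx j z * cx k z)"
    using less[of j k] less[of k j] bracket_antisym[OF \<pi>, of "cx j" "cx k" z]
    by (cases j k rule: linorder_cases) (auto simp: sgn_diff_def bracket_self[OF \<pi>])
qed

lemma bracket_cp_cp: "bracket \<pi> (cp j) (cp k) = (\<lambda>z. - \<epsilon> * sgn_diff k j * (cp j z * cp k z))"
proof
  fix z
  have less: "bracket \<pi> (cp j) (cp k) z = - \<epsilon> * cp j z * cp k z" if "j < k" for j k
    using br that unfolding cotangent_brackets_def by blast
  show "bracket \<pi> (cp j) (cp k) z = - \<epsilon> * sgn_diff k j * (cp j z * cp k z)"
    using less[of j k] less[of k j] bracket_antisym[OF \<pi>, of "cp j" "cp k" z]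
    by (cases j k rule: linorder_cases) (auto simp: sgn_diff_def bracket_self[OF \<pi>])
qed

lemma bracket_cx_cp:
  "bracket \<pi> (cx j) (cp k) = (\<lambda>z. \<epsilon> * (cx j z * cp k z) + (if j = k then diagonal_term \<epsilon> j z else 0))"
proof
  fix z
  have "bracket \<pi> (cx j) (cp k) z = - (if j = k then 1 else 0)
      + \<epsilon> * (cx j z * cp k z
             + (if j = k then 1 else 0) * (\<Sum>i\<in>UNIV. (1 - sgn_diff i j) * cx i z * cp i z))"
    using br unfolding cotangent_brackets_def by blast
  then show "bracket \<pi> (cx j) (cp k) z = \<epsilon> * (cx j z * cp k z) + (if j = k then diagonal_term \<epsilon> j z else 0)"
    by (cases "j = k") (simp_all add: diagonal_term_def algebra_simps)
qed

lemma bracket_cp_cx: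
  "bracket \<pi> (cp k) (cx j) = (\<lambda>z. - \<epsilon> * (cp k z * cx j z) - (if j = k then diagonal_term \<epsilon> j z else 0))"
  by (rule ext) (simp add: bracket_antisym[OF \<pi>, of "cp k" "cx j"] bracket_cx_cp)

lemma bracket_diagonal_term_expand:
  "bracket \<pi> f (diagonal_term \<epsilon> j) z =
    \<epsilon> * (\<Sum>i\<in>UNIV. (1 - sgn_diff i j) * (cx i z * bracket \<pi> f (cp i) z + bracket \<pi> f (cx i) z * cp i z))"
  unfolding diagonal_term_def[abs_def]
  by (subst bracket_add_right[OF \<pi>])
    (simp_all add: bracket_cmult_right[OF \<pi>] bracket_sum_right[OF \<pi>] bracket_mult_right[OF \<pi>]
      bracket_const_right[OF \<pi>] differentiable_cx differentiable_cp differentiable_mult)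

text \<open>Compares the coefficients of x^i p_i in {x^k, \<phi>_j} and in its multiple of x^k
  \<phi>_j. For j \<noteq> k the weight 1 - sgn(k - j) is 0 or 2, which settles each position of i;
  for i = j = k the two sides would be 2 and 1.\<close>

lemma sgn_diff_weights:
  fixes i j k :: 'n
  assumes "j \<noteq> k"
  shows "(1 - sgn_diff i j) * (1 + sgn_diff i k) + (1 - sgn_diff k j) * (1 - sgn_diff i k)
    = (1 - sgn_diff k j) * (1 - sgn_diff i j)"
  using assms by (auto simp: sgn_diff_def)

text \<open>By the Leibniz rule {x^k, x^i p_i} is \<epsilon> (1 + sgn(i - k)) x^i p_i x^k, with an
  extra x^k \<phi>_k when i = k. \<open>sgn_diff_weights\<close> recombines the sum, \<phi>_k
  included, into a multiple of \<phi>_j. Replacing x^k by p_k changes only the sign.\<close>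

lemma bracket_diagonal_term_log_canonical:
  assumes "j \<noteq> k"
  shows "bracket \<pi> (cx k) (diagonal_term \<epsilon> j) z = \<epsilon> * (1 - sgn_diff k j) * (cx k z * diagonal_term \<epsilon> j z)"
    and "bracket \<pi> (cp k) (diagonal_term \<epsilon> j) z = - \<epsilon> * (1 - sgn_diff k j) * (cp k z * diagonal_term \<epsilon> j z)"
proof -
  let ?w = "\<lambda>i. cx i z * cp i z"
  have weights: "(\<Sum>i\<in>UNIV. (1 - sgn_diff i j) * (\<epsilon> * (1 + sgn_diff i k) * ?w i))
      + (1 - sgn_diff k j) * diagonal_term \<epsilon> k z = (1 - sgn_diff k j) * diagonal_term \<epsilon> j z"
  proof -
    have "(\<Sum>i\<in>UNIV. (1 - sgn_diff i j) * (\<epsilon> * (1 + sgn_diff i k) * ?w i))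
        + (1 - sgn_diff k j) * (\<epsilon> * (\<Sum>i\<in>UNIV. (1 - sgn_diff i k) * ?w i))
      = (1 - sgn_diff k j) * (\<epsilon> * (\<Sum>i\<in>UNIV. (1 - sgn_diff i j) * ?w i))"
      unfolding sum_distrib_left sum.distrib[symmetric]
    proof (rule sum.cong[OF refl])
      fix i
      show "(1 - sgn_diff i j) * (\<epsilon> * (1 + sgn_diff i k) * ?w i)
          + (1 - sgn_diff k j) * (\<epsilon> * ((1 - sgn_diff i k) * ?w i))
        = (1 - sgn_diff k j) * (\<epsilon> * ((1 - sgn_diff i j) * ?w i))"
        using arg_cong[OF sgn_diff_weights[OF assms, of i], of "\<lambda>t. \<epsilon> * ?w i * t"]
        by (simp add: algebra_simps)
    qed
    \<comment> \<open>The constants -1 of both diagonal terms carry the same weight 1 - sgn(k - j),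
      so only the sums had to be compared.\<close>
    moreover have "s + b * (- 1 + t) = b * (- 1 + u)" if "s + b * t = b * u" for s b t u :: real
      using that by (simp add: algebra_simps)
    ultimately show ?thesis unfolding diagonal_term_def by blast
  qed
  have "bracket \<pi> (cx k) (diagonal_term \<epsilon> j) z = \<epsilon> * (\<Sum>i\<in>UNIV. (1 - sgn_diff i j) * (\<epsilon> * (1 + sgn_diff i k) * ?w i) * cx k z
     + (if i = k then (1 - sgn_diff k j) * diagonal_term \<epsilon> k z * cx k z else 0))"
    unfolding bracket_diagonal_term_expand
    by (intro arg_cong2[where f="(*)"] sum.cong refl) (simp add: bracket_cx_cx bracket_cx_cp algebra_simps)
  also have "\<dots> = \<epsilon> * cx k z * ((\<Sum>i\<in>UNIV. (1 - sgn_diff i j) * (\<epsilon> * (1 + sgn_diff i k) * ?w i))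
      + (1 - sgn_diff k j) * diagonal_term \<epsilon> k z)"
    by (simp only: sum.distrib sum_distrib_right[symmetric]) (simp add: algebra_simps)
  finally show "bracket \<pi> (cx k) (diagonal_term \<epsilon> j) z = \<epsilon> * (1 - sgn_diff k j) * (cx k z * diagonal_term \<epsilon> j z)"
    unfolding weights by simp
  have "bracket \<pi> (cp k) (diagonal_term \<epsilon> j) z = \<epsilon> * (\<Sum>i\<in>UNIV. (1 - sgn_diff i j) * (\<epsilon> * (1 + sgn_diff i k) * ?w i) * - cp k z
     + (if i = k then (1 - sgn_diff k j) * diagonal_term \<epsilon> k z * - cp k z else 0))"
    unfolding bracket_diagonal_term_expand
    by (intro arg_cong2[where f="(*)"] sum.cong refl) (simp add: bracket_cp_cp bracket_cp_cx algebra_simps)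
  also have "\<dots> = \<epsilon> * - cp k z * ((\<Sum>i\<in>UNIV. (1 - sgn_diff i j) * (\<epsilon> * (1 + sgn_diff i k) * ?w i))
      + (1 - sgn_diff k j) * diagonal_term \<epsilon> k z)"
    by (simp only: sum.distrib sum_distrib_right[symmetric]) (simp add: algebra_simps)
  finally show "bracket \<pi> (cp k) (diagonal_term \<epsilon> j) z = - \<epsilon> * (1 - sgn_diff k j) * (cp k z * diagonal_term \<epsilon> j z)"
    unfolding weights by simp
qed

lemma differentiable_diagonal_term: "diagonal_term \<epsilon> j differentiable (at z)"
  by (rule smooth_on_differentiable[OF smooth_on_diagonal_term]) simp

text \<open>For the triple with x^k, the terms in \<epsilon> x^k \<phi>_j have coefficients 1 -
  sgn(k - j), -1 and sgn(k - j), with sum 0; the rest cancels as for log-canonical brackets. For p_k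
  the corresponding coefficients change sign.\<close>

lemma jacobi_sum_conjugate_pair:
  assumes "j \<noteq> k"
  shows "jacobi_sum \<pi> (cx k) (cx j) (cp j) z = 0" and "jacobi_sum \<pi> (cp k) (cx j) (cp j) z = 0"
proof -
  note simps = bracket_cx_cx bracket_cp_cp bracket_cx_cp bracket_cp_cx
    bracket_add_right[OF \<pi>] bracket_cmult_right[OF \<pi>] bracket_mult_right[OF \<pi>]
    bracket_minus_right[OF \<pi>] bracket_const_right[OF \<pi>] differentiable_const
    differentiable_cx differentiable_cp differentiable_diagonal_term differentiable_mult
    bracket_diagonal_term_log_canonical[OF assms] sgn_diff_antisym[of j k]
  show "jacobi_sum \<pi> (cx k) (cx j) (cp j) z = 0"
    using assms by (simp add: jacobi_sum_def simps) (simp add: algebra_simps)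
  show "jacobi_sum \<pi> (cp k) (cx j) (cp j) z = 0"
    using assms by (simp add: jacobi_sum_def simps) (simp add: algebra_simps)
qed

lemma jacobi_sum_cx_cx_cp: "jacobi_sum \<pi> (cx i) (cx j) (cp k) z = 0"
proof -
  consider "i = j" | "i \<noteq> j" "k = j" | "i \<noteq> j" "k = i" | "k \<noteq> i" "k \<noteq> j" by blast
  then show ?thesis
  proof cases
    case 1
    then show ?thesis by (simp add: jacobi_sum_self[OF \<pi>] smooth_on_cx smooth_on_cp)
  next
    case 2
    then show ?thesis by (simp add: jacobi_sum_conjugate_pair)
  next
    case 3
    then show ?thesis
      by (simp add: jacobi_sum_swap[OF \<pi>, of "cx i"] smooth_on_cx smooth_on_cp jacobi_sum_conjugate_pair)
  next
    case 4
    have "bracket \<pi> (cx j) (cp k) = (\<lambda>z. \<epsilon> * (cx j z * cp k z))"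
      "bracket \<pi> (cp k) (cx i) = (\<lambda>z. - \<epsilon> * (cp k z * cx i z))"
      using 4 by (auto simp: bracket_cx_cp bracket_cp_cx)
    then show ?thesis
      by (intro jacobi_sum_log_canonical[OF \<pi> _ _ _ bracket_cx_cx] smooth_on_cx smooth_on_cp)
  qed
qed

lemma jacobi_sum_cp_cp_cx: "jacobi_sum \<pi> (cp i) (cp j) (cx k) z = 0"
proof -
  consider "i = j" | "i \<noteq> j" "k = j" | "i \<noteq> j" "k = i" | "k \<noteq> i" "k \<noteq> j" by blast
  then show ?thesis
  proof cases
    case 1
    then show ?thesis by (simp add: jacobi_sum_self[OF \<pi>] smooth_on_cx smooth_on_cp)
  next
    case 2
    then have "jacobi_sum \<pi> (cp j) (cx j) (cp i) z = 0"
      by (simp add: jacobi_sum_swap[OF \<pi>, of "cp j"] jacobi_sum_cyclic[of \<pi> "cx j" "cp j" "cp i", symmetric]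
         jacobi_sum_cyclic[of \<pi> "cp i" "cx j" "cp j", symmetric]
          smooth_on_cx smooth_on_cp jacobi_sum_conjugate_pair)
    then show ?thesis
      using 2 jacobi_sum_cyclic[of \<pi> "cp i" "cp j" "cx j" z] by simp
  next
    case 3
    then show ?thesis
      using jacobi_sum_cyclic[of \<pi> "cp j" "cx i" "cp i" z] jacobi_sum_cyclic[of \<pi> "cx i" "cp i" "cp j" z]
      by (simp add: jacobi_sum_conjugate_pair)
  next
    case 4
    have "bracket \<pi> (cp j) (cx k) = (\<lambda>z. - \<epsilon> * (cp j z * cx k z))"
      "bracket \<pi> (cx k) (cp i) = (\<lambda>z. \<epsilon> * (cx k z * cp i z))"
      using 4 by (auto simp: bracket_cx_cp bracket_cp_cx)
    then show ?thesis
      by (intro jacobi_sum_log_canonical[OF \<pi> _ _ _ bracket_cp_cp] smooth_on_cx smooth_on_cp)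
  qed
qed

lemma poisson_structure_cotangent: "poisson_structure \<pi>"
proof (rule poisson_structure_coordinatesI[OF \<pi>], fold jacobi_sum_def)
  fix a b c :: "(real^'n::{finite,linorder}) \<times> (real^'n::{finite,linorder})" and z
  assume basis: "a \<in> Basis" "b \<in> Basis" "c \<in> Basis"
  have xxx: "jacobi_sum \<pi> (cx i) (cx j) (cx k) z = 0" for i j k
    by (intro jacobi_sum_log_canonical[OF \<pi> _ _ _ bracket_cx_cx bracket_cx_cx bracket_cx_cx] smooth_on_cx)
  have ppp: "jacobi_sum \<pi> (cp i) (cp j) (cp k) z = 0" for i j k
    by (intro jacobi_sum_log_canonical[OF \<pi> _ _ _ bracket_cp_cp bracket_cp_cp bracket_cp_cp] smooth_on_cp)
  \<comment> \<open>Cyclic rotation supplies the remaining four of the eight patterns in which x and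
    p can occupy three slots.\<close>
  have "jacobi_sum \<pi> (cp k) (cx i) (cx j) z = 0" "jacobi_sum \<pi> (cx i) (cp k) (cx j) z = 0"
    "jacobi_sum \<pi> (cx k) (cp i) (cp j) z = 0" "jacobi_sum \<pi> (cp i) (cx k) (cp j) z = 0" for i j k
    using jacobi_sum_cx_cx_cp jacobi_sum_cp_cp_cx jacobi_sum_cyclic by metis+
  with xxx ppp jacobi_sum_cx_cx_cp jacobi_sum_cp_cp_cx
  show "jacobi_sum \<pi> ((\<bullet>) a) ((\<bullet>) b) ((\<bullet>) c) z = 0"
    by (cases rule: Basis_cotangent_cases[OF basis(1)]; cases rule: Basis_cotangent_cases[OF basis(2)];
        cases rule: Basis_cotangent_cases[OF basis(3)]) simp_all
qed

end

text \<open>The differentials of the coordinates form a basis of the covectors, so the prescribed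
  brackets and skew-symmetry fix every coefficient.\<close>

lemma cotangent_brackets_unique:
  assumes "bivector_field \<pi>" "cotangent_brackets \<epsilon> \<pi>" "bivector_field \<pi>'" "cotangent_brackets \<epsilon> \<pi>'"
  shows "\<pi>' = \<pi>"
proof
  fix z
  show "\<pi>' z = \<pi> z"
  proof (rule bivec_eqI)
    show "bounded_bilinear (\<pi>' z)" "bounded_bilinear (\<pi> z)"
      using assms by (auto intro: bivector_field_bilinear)
    fix a b :: "(real^'a::{finite,linorder}) \<times> (real^'a::{finite,linorder})"
    assume "a \<in> Basis" "b \<in> Basis"
    then have "bracket \<pi>' ((\<bullet>) a) ((\<bullet>) b) z = bracket \<pi> ((\<bullet>) a) ((\<bullet>) b) z"
      by (cases rule: Basis_cotangent_cases; cases rule: Basis_cotangent_cases[OF \<open>b \<in> Basis\<close>])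
        (simp_all add: bracket_cx_cx[OF assms(1,2)] bracket_cx_cx[OF assms(3,4)]
          bracket_cp_cp[OF assms(1,2)] bracket_cp_cp[OF assms(3,4)]
          bracket_cx_cp[OF assms(1,2)] bracket_cx_cp[OF assms(3,4)]
          bracket_cp_cx[OF assms(1,2)] bracket_cp_cx[OF assms(3,4)])
    then show "\<pi>' z (blinfun_inner_right a) (blinfun_inner_right b) = \<pi> z (blinfun_inner_right a) (blinfun_inner_right b)"
      by (simp add: bracket_inner)
  qed
qed

section \<open>Projection, non-degeneracy and the zero section\<close>

text \<open>Differentials of functions pulled back from M factor through \<open>fst\<close>. The
  claim thus becomes a pointwise identity of bilinear forms on covectors of M, to be checked on a
  basis, where both sides are brackets of the x^j.\<close>

lemma poisson_map_fst:
  fixes \<epsilon> :: real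
  shows "poisson_map (cotangent_field \<epsilon>) (standard_r_field \<epsilon>)
    (fst :: (real^'n::{finite,linorder}) \<times> (real^'n::{finite,linorder}) \<Rightarrow> _)"
  unfolding poisson_map_def
proof (intro conjI allI impI)
  show "smooth_on UNIV (fst :: (real^'n::{finite,linorder}) \<times> (real^'n::{finite,linorder}) \<Rightarrow> _)"
    by (rule smooth_on_bounded_linear[OF bounded_linear_fst])
next
  fix f g :: "real^'n::{finite,linorder} \<Rightarrow> real"
  assume "smooth_on UNIV f \<and> smooth_on UNIV g"
  then have d: "f differentiable (at x)" "g differentiable (at x)" for x
    by (auto intro: smooth_on_differentiable)
  have pull: "differential (h \<circ> fst) z = differential h (fst z) o\<^sub>L fst_blinfun"
    if h: "\<And>x. h differentiable (at x)" for h :: "real^'n::{finite,linorder} \<Rightarrow> real"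
      and z :: "(real^'n::{finite,linorder}) \<times> (real^'n::{finite,linorder})"
  proof -
    have fst: "fst differentiable (at z)"
      by (rule bounded_linear_imp_differentiable[OF bounded_linear_fst])
    have "(h \<circ> fst) differentiable (at z)"
      by (rule differentiable_chain_at[OF fst h])
    then show ?thesis
      by (intro blinfun_eqI) (simp add: blinfun_apply_differential h frechet_derivative_compose[OF fst h]
          frechet_derivative_bounded_linear[OF bounded_linear_fst])
  qed
  have eq: "(\<lambda>\<alpha> \<beta>. cotangent_field \<epsilon> z (\<alpha> o\<^sub>L fst_blinfun) (\<beta> o\<^sub>L fst_blinfun)) = standard_r_field \<epsilon> (fst z)"
    for z :: "(real^'n::{finite,linorder}) \<times> (real^'n::{finite,linorder})"
  proof (rule bivec_eqI)
    show "bounded_bilinear (\<lambda>\<alpha> \<beta>. cotangent_field \<epsilon> z (\<alpha> o\<^sub>L fst_blinfun) (\<beta> o\<^sub>L fst_blinfun))"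
      by (intro bounded_bilinear.comp[OF bivector_field_bilinear[OF bivector_field_cotangent]]
          bounded_bilinear.bounded_linear_left[OF bounded_bilinear_blinfun_compose])
    show "bounded_bilinear (standard_r_field \<epsilon> (fst z))"
      by (rule bivector_field_bilinear[OF bivector_field_standard_r])
    fix a b :: "real^'n::{finite,linorder}"
    assume "a \<in> Basis" "b \<in> Basis"
    then obtain j k where jk: "a = axis j 1" "b = axis k 1"
      by (auto simp: Basis_vec_def)
    have e: "blinfun_inner_right c o\<^sub>L fst_blinfun = blinfun_inner_right (c, 0)" for c :: "real^'n::{finite,linorder}"
      by (rule blinfun_eqI) (simp add: blinfun_inner_right.rep_eq inner_prod_def)
    show "cotangent_field \<epsilon> z (blinfun_inner_right a o\<^sub>L fst_blinfun) (blinfun_inner_right b o\<^sub>L fst_blinfun)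
        = standard_r_field \<epsilon> (fst z) (blinfun_inner_right a) (blinfun_inner_right b)"
      using fun_cong[OF bracket_cx_cx[OF bivector_field_cotangent cotangent_brackets_cotangent_field], of \<epsilon> j k z]
        fun_cong[OF bracket_standard_r, of \<epsilon> j k "fst z"]
      unfolding e jk cx_eq_inner[of j] cx_eq_inner[of k] vec_nth_eq_inner[of j] vec_nth_eq_inner[of k] bracket_inner
      by (simp add: inner_axis' inner_prod_def)
  qed
  show "bracket (cotangent_field \<epsilon>) (f \<circ> fst) (g \<circ> fst) = bracket (standard_r_field \<epsilon>) f g \<circ> fst"
  proof
    fix z :: "(real^'n::{finite,linorder}) \<times> (real^'n::{finite,linorder})"
    show "bracket (cotangent_field \<epsilon>) (f \<circ> fst) (g \<circ> fst) z = (bracket (standard_r_field \<epsilon>) f g \<circ> fst) z"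
      by (simp add: bracket_def pull d eq[symmetric])
  qed
qed

section \<open>Non-degeneracy along the two axes\<close>

lemma cotangent_field_on_axes:
  assumes "fst z = 0 \<or> snd z = 0"
  shows "cotangent_field \<epsilon> z \<alpha> \<beta> = (\<Sum>j\<in>UNIV. \<Sum>k\<in>UNIV.
     (\<epsilon> / 2 * sgn_diff k j * (cx j z * cx k z)) * wedge (axis j 1, 0) (axis k 1, 0) \<alpha> \<beta>
   + (- \<epsilon> / 2 * sgn_diff k j * (cp j z * cp k z)) * wedge (0, axis j 1) (0, axis k 1) \<alpha> \<beta>)
   - (\<Sum>j\<in>UNIV. wedge (axis j 1, 0) (0, axis j 1) \<alpha> \<beta>)"
proof -
  have z: "cx j z * cp k z = 0" for j k
    using assms by (auto simp: cx_def cp_def)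
  have "diagonal_term \<epsilon> j z = - 1" for j
    unfolding diagonal_term_def z by simp
  then show ?thesis
    unfolding cotangent_field_def z
    by (simp add: sum.distrib sum_subtractf sum_negf if_distrib[of "\<lambda>c. c * _"]
      cong: if_cong)
qed

lemma covector_cotangent_eqI:
  fixes \<alpha> \<beta> :: "((real^'n::finite) \<times> (real^'n::finite)) \<Rightarrow>\<^sub>L real"
  assumes "\<And>j. blinfun_apply \<alpha> (axis j 1, 0) = blinfun_apply \<beta> (axis j 1, 0)"
    and "\<And>j. blinfun_apply \<alpha> (0, axis j 1) = blinfun_apply \<beta> (0, axis j 1)"
  shows "\<alpha> = \<beta>"
proof (rule blinfun_euclidean_eqI)
  fix b :: "(real^'n) \<times> (real^'n)"
  assume "b \<in> Basis"
  then show "blinfun_apply \<alpha> b = blinfun_apply \<beta> b"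
    by (cases rule: Basis_cotangent_cases) (simp_all add: assms)
qed

text \<open>Pairing \<alpha> with dx^k gives its k-th p-component plus terms quadratic in x; pairing
  with dp_k gives minus its k-th x-component plus terms quadratic in p. On an axis one family of
  quadratic terms vanishes, which kills half of the components, and the other family of equations
  then kills the rest.\<close>

lemma nondegenerate_cotangent_field:
  fixes z :: "(real^'n::{finite,linorder}) \<times> (real^'n::{finite,linorder})"
  assumes z: "fst z = 0 \<or> snd z = 0"
  shows "nondegenerate (cotangent_field \<epsilon> z)"
  unfolding nondegenerate_def
proof (intro allI impI)
  fix \<alpha>
  assume 0: "\<forall>\<beta>. cotangent_field \<epsilon> z \<alpha> \<beta> = 0"
  let ?X = "\<lambda>j. blinfun_apply \<alpha> (axis j 1, 0)" and ?P = "\<lambda>j. blinfun_apply \<alpha> (0, axis j 1)"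
  have ax: "axis i (1::real) \<bullet> axis l 1 = (if l = i then 1 else 0)" for i l :: 'n
    by (auto simp: inner_axis_axis)
  \<comment> \<open>Summation against a wedge antisymmetrises the coefficient c; for the
    antisymmetric coefficients used below this doubles it and removes the factor 1/2.\<close>
  have swap: "(\<Sum>j\<in>UNIV. \<Sum>k\<in>UNIV. c j k * (a j * (if k = l then 1 else 0) - a k * (if j = l then 1 else 0)))
      = (\<Sum>j\<in>UNIV. (c j l - c l j) * a j)" for c :: "'n \<Rightarrow> 'n \<Rightarrow> real" and a l
  proof -
    have "(\<Sum>j\<in>UNIV. \<Sum>k\<in>UNIV. c j k * (a k * (if j = l then 1 else 0))) = (\<Sum>k\<in>UNIV. c l k * a k)"
      by (subst sum.swap) (simp add: if_distrib[of "\<lambda>t. _ * t"] cong: if_cong)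
    moreover have "(\<Sum>j\<in>UNIV. \<Sum>k\<in>UNIV. c j k * (a j * (if k = l then 1 else 0))) = (\<Sum>j\<in>UNIV. c j l * a j)"
      by (simp add: if_distrib[of "\<lambda>t. _ * t"] cong: if_cong)
    ultimately show ?thesis by (simp add: right_diff_distrib left_diff_distrib sum_subtractf)
  qed
  have dx: "(\<Sum>j\<in>UNIV. (\<epsilon> * sgn_diff k j * (cx j z * cx k z)) * ?X j) + ?P k = 0" for k
  proof -
    have "cotangent_field \<epsilon> z \<alpha> (blinfun_inner_right (axis k 1, 0)) =
      (\<Sum>j\<in>UNIV. \<Sum>l\<in>UNIV. (\<epsilon> / 2 * sgn_diff l j * (cx j z * cx l z)) *
         (?X j * (if l = k then 1 else 0) - ?X l * (if j = k then 1 else 0)))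
      - (\<Sum>j\<in>UNIV. - (if j = k then ?P j else 0))"
      unfolding cotangent_field_on_axes[OF z]
      by (intro arg_cong2[where f="(-)"] sum.cong refl)
        (auto simp: wedge_def blinfun_inner_right.rep_eq inner_Pair ax)
    also have "\<dots> = (\<Sum>j\<in>UNIV. (\<epsilon> * sgn_diff k j * (cx j z * cx k z)) * ?X j) + ?P k"
      unfolding swap by (simp add: sum_negf sgn_diff_antisym[of _ k] mult_ac)
    finally show ?thesis using 0 by simp
  qed
  have dp: "(\<Sum>j\<in>UNIV. (- \<epsilon> * sgn_diff k j * (cp j z * cp k z)) * ?P j) - ?X k = 0" for k
  proof -
    have "cotangent_field \<epsilon> z \<alpha> (blinfun_inner_right (0, axis k 1)) =
      (\<Sum>j\<in>UNIV. \<Sum>l\<in>UNIV. (- \<epsilon> / 2 * sgn_diff l j * (cp j z * cp l z)) *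
         (?P j * (if l = k then 1 else 0) - ?P l * (if j = k then 1 else 0)))
      - (\<Sum>j\<in>UNIV. (if j = k then ?X j else 0))"
      unfolding cotangent_field_on_axes[OF z]
      by (intro arg_cong2[where f="(-)"] sum.cong refl)
        (auto simp: wedge_def blinfun_inner_right.rep_eq inner_Pair ax)
    also have "\<dots> = (\<Sum>j\<in>UNIV. (- \<epsilon> * sgn_diff k j * (cp j z * cp k z)) * ?P j) - ?X k"
      unfolding swap by (simp add: sum_negf sgn_diff_antisym[of _ k] mult_ac)
    finally show ?thesis using 0 by simp
  qed
  have "?X k = 0 \<and> ?P k = 0" for k
    using z
  proof
    assume "fst z = 0"
    then have "?P k = 0" for k using dx[of k] by (simp add: cx_def)
    then show ?thesis using dp[of k] by simp
  next
    assume "snd z = 0"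
    then have "?X k = 0" for k using dp[of k] by (simp add: cp_def)
    then show ?thesis using dx[of k] by simp
  qed
  then show "\<alpha> = 0" by (intro covector_cotangent_eqI) simp_all
qed

text \<open>At p = 0 the p-p part of \<pi> vanishes, and the x-x part does not see covectors in the
  dp-directions. So only the canonical part acts on such covectors, and the covector of a horizontal
  vector (v, 0) is \<open>blinfun_inner_right (0, v)\<close>.\<close>

lemma symplectic_form_zero_section:
  fixes z :: "(real^'n::{finite,linorder}) \<times> (real^'n::{finite,linorder})"
  assumes z: "snd z = 0"
  shows "symplectic_form (cotangent_field \<epsilon>) z u (v, 0) = v \<bullet> snd u"
proof -
  let ?\<pi> = "cotangent_field \<epsilon> z"
  note bil = bivector_field_bilinear[OF bivector_field_cotangent, of \<epsilon> z]
  have nd: "nondegenerate ?\<pi>" using z by (simp add: nondegenerate_cotangent_field)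
  have "?\<pi> (blinfun_inner_right (0, v)) \<beta> = blinfun_apply \<beta> (v, 0)" for \<beta>
  proof -
    have "?\<pi> (blinfun_inner_right (0, v)) \<beta> = (\<Sum>j\<in>UNIV. v $ j * blinfun_apply \<beta> (axis j 1, 0))"
      using z unfolding cotangent_field_on_axes[OF disjI2[OF z]]
      by (simp add: cp_def wedge_def blinfun_inner_right.rep_eq inner_Pair_0 inner_axis sum_negf)
    also have "\<dots> = blinfun_apply \<beta> (\<Sum>j\<in>UNIV. v $ j *\<^sub>R (axis j 1, 0))"
      by (simp only: blinfun.sum_right blinfun.scaleR_right real_scaleR_def)
    also have "(\<Sum>j\<in>UNIV. v $ j *\<^sub>R (axis j 1, 0)) = (v, 0 :: real^'n::{finite,linorder})"
      by (simp add: prod_eq_iff fst_sum snd_sum vec_eq_iff axis_def if_distrib[of "\<lambda>c. _ * c"] cong: if_cong)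
    finally show ?thesis .
  qed
  then have "flat ?\<pi> (v, 0) = blinfun_inner_right (0, v)"
    by (intro flat_eqI[OF bil nd] sharp_eqI)
  moreover have "z \<in> nondegeneracy_locus (cotangent_field \<epsilon>)"
    using nd by (simp add: nondegeneracy_locus_def)
  ultimately show ?thesis
    by (simp add: symplectic_form_eq[OF bivector_field_cotangent] blinfun_inner_right.rep_eq inner_prod_def)
qed

section \<open>Linear subspaces as submanifolds; the zero section\<close>

lemma submanifold_subspace:
  fixes L :: "'a::euclidean_space set"
  assumes "subspace L"
  shows "submanifold (dim L) L"
  unfolding submanifold_def
proof
  fix z assume "z \<in> L"
  have id: "smooth_on UNIV (\<lambda>x :: 'a. x)"
    by (rule smooth_on_bounded_linear[OF bounded_linear_ident])
  show "\<exists>W (\<phi> :: 'a \<Rightarrow> 'a) \<psi> S. open W \<and> z \<in> W \<and> open (\<phi> ` W) \<and> smooth_on W \<phi> \<and>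
      smooth_on (\<phi> ` W) \<psi> \<and> (\<forall>x\<in>W. \<psi> (\<phi> x) = x) \<and> subspace S \<and> dim S = dim L \<and> \<phi> ` (W \<inter> L) = \<phi> ` W \<inter> S"
    by (rule exI[of _ UNIV], rule exI[of _ "\<lambda>x. x"], rule exI[of _ "\<lambda>x. x"], rule exI[of _ L]) (use assms id in auto)
qed

text \<open>Straight lines realise every vector of L. Conversely, for w orthogonal to L the function
  \<gamma> \<bullet> w is constantly 0 near 0, so the velocity is orthogonal to w.\<close>

lemma tangent_space_subspace:
  fixes L :: "'a::euclidean_space set"
  assumes L: "subspace L" and "z \<in> L"
  shows "tangent_space L z = L"
proof (intro equalityI subsetI)
  fix v assume v: "v \<in> L"
  let ?\<gamma> = "\<lambda>t :: real. z + t *\<^sub>R v"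
  have "smooth_on {-1<..<1} ?\<gamma>"
    by (intro smooth_on_add smooth_on_const smooth_on_bounded_linear bounded_linear_scaleR_left) simp
  moreover have "?\<gamma> ` {-1<..<1} \<subseteq> L"
    using assms v by (auto intro: subspace_add subspace_scale)
  moreover have "(?\<gamma> has_vector_derivative v) (at 0)"
    by (auto intro!: derivative_eq_intros)
  ultimately show "v \<in> tangent_space L z"
    unfolding tangent_space_def by (intro CollectI exI[of _ "1::real"] conjI exI[of _ ?\<gamma>]) auto
next
  fix v assume "v \<in> tangent_space L z"
  then obtain \<delta> \<gamma> where \<gamma>: "\<delta> > 0" "\<gamma> ` {-\<delta><..<\<delta>} \<subseteq> L" "(\<gamma> has_vector_derivative v) (at 0)"
    unfolding tangent_space_def by blast
  have "v \<bullet> w = 0" if "\<And>y. y \<in> L \<Longrightarrow> orthogonal w y" for w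
  proof -
    have "((\<lambda>t. \<gamma> t \<bullet> w) has_vector_derivative v \<bullet> w) (at 0)"
      by (rule bounded_linear.has_vector_derivative[OF bounded_linear_inner_left \<gamma>(3)])
    moreover have "((\<lambda>t. \<gamma> t \<bullet> w) has_vector_derivative 0) (at 0)"
    proof (rule has_vector_derivative_transform_within_open[OF has_vector_derivative_const])
      show "0 = \<gamma> t \<bullet> w" if "t \<in> {-\<delta><..<\<delta>}" for t
        using that \<gamma>(2) \<open>\<And>y. y \<in> L \<Longrightarrow> orthogonal w y\<close> by (force simp: orthogonal_def inner_commute)
    qed (use \<gamma>(1) in auto)
    ultimately show ?thesis by (rule vector_derivative_unique_at)
  qed
  note orth = this
  \<comment> \<open>Taking w to be the component of v normal to L shows that this component is
    orthogonal to itself.\<close>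
  obtain a b where ab: "a \<in> span L" "\<And>w. w \<in> span L \<Longrightarrow> orthogonal b w" "v = a + b"
    using orthogonal_subspace_decomp_exists[of L v] by metis
  then have "v \<bullet> b = 0" "a \<bullet> b = 0"
    using orth[of b] span_base[of _ L] by (auto simp: orthogonal_def inner_commute)
  then have "b = 0" using ab(3) by (simp add: inner_add_left)
  moreover have "span L = L" using L span_eq_iff by blast
  ultimately show "v \<in> L" using ab(1,3) by (metis add.right_neutral)
qed

lemma lagrangian_zero_section:
  "lagrangian_submanifold (nondegeneracy_locus (cotangent_field \<epsilon>)) (symplectic_form (cotangent_field \<epsilon>))
    {(x :: real^'n::{finite,linorder}, p :: real^'n::{finite,linorder}). p = 0}"
  unfolding lagrangian_submanifold_def
proof (intro conjI ballI)
  let ?L = "{(x :: real^'n::{finite,linorder}, p :: real^'n::{finite,linorder}). p = 0}"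
  let ?\<pi> = "cotangent_field \<epsilon> :: (real^'n::{finite,linorder}) \<times> (real^'n::{finite,linorder}) \<Rightarrow> _"
  have L: "?L = UNIV \<times> {0}" by auto
  have sub: "subspace ?L"
    unfolding L by (intro subspace_Times) auto
  show "symplectic_on (nondegeneracy_locus ?\<pi>) (symplectic_form ?\<pi>)"
    by (intro symplectic_on_nondegeneracy_locus bivector_field_cotangent
        poisson_structure_cotangent[OF bivector_field_cotangent cotangent_brackets_cotangent_field])
  show "?L \<subseteq> nondegeneracy_locus ?\<pi>"
    by (auto simp: nondegeneracy_locus_def intro: nondegenerate_cotangent_field)
  have "dim ?L = CARD('n)"
    unfolding L by (subst dim_Times) (auto simp: dim_UNIV)
  with submanifold_subspace[OF sub]
  show "\<exists>k. 2 * k = DIM((real^'n::{finite,linorder}) \<times> (real^'n::{finite,linorder})) \<and> submanifold k ?L"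
    by (intro exI[of _ "CARD('n)"]) simp
  fix z assume z: "z \<in> ?L"
  \<comment> \<open>Pairing with all horizontal vectors tests exactly the vertical component of u,
    so the symplectic orthogonal is again the horizontal space.\<close>
  have "{u. \<forall>v\<in>?L. symplectic_form ?\<pi> z u v = 0} = {u. \<forall>v :: real^'n::{finite,linorder}. v \<bullet> snd u = 0}"
    using z by (auto simp: symplectic_form_zero_section)
  also have "\<dots> = ?L"
    by auto (metis inner_eq_zero_iff)
  finally show "tangent_space ?L z = {u. \<forall>v\<in>tangent_space ?L z. symplectic_form ?\<pi> z u v = 0}"
    by (simp add: tangent_space_subspace[OF sub z])
qed

text \<open>Existence together with uniqueness expresses that the brackets define the bi-vector
  field; the remaining conjuncts speak about that one field.\<close>

theorem mainTheorem4:
  fixes \<epsilon> :: real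
  shows "\<exists>\<pi> :: (real^'n::{finite,linorder}) \<times> (real^'n::{finite,linorder}) \<Rightarrow> ((real^'n::{finite,linorder}) \<times> (real^'n::{finite,linorder})) bivec.
      (bivector_field \<pi> \<and> cotangent_brackets \<epsilon> \<pi>)
    \<and> (\<forall>\<pi>'. bivector_field \<pi>' \<and> cotangent_brackets \<epsilon> \<pi>' \<longrightarrow> \<pi>' = \<pi>)
    \<and> poisson_structure \<pi>
    \<and> poisson_structure (standard_r_field \<epsilon> :: real^'n::{finite,linorder} \<Rightarrow> (real^'n::{finite,linorder}) bivec)
    \<and> (\<forall>(j::'n) k x. j < k \<longrightarrow>
          bracket (standard_r_field \<epsilon>) (\<lambda>y. y $ j) (\<lambda>y. y $ k) x = \<epsilon> * x $ j * x $ k)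
    \<and> poisson_map \<pi> (standard_r_field \<epsilon>) fst
    \<and> (\<exists>W. open W \<and> UNIV \<times> {0} \<union> {0} \<times> UNIV \<subseteq> W \<and> (\<forall>z\<in>W. nondegenerate (\<pi> z)))
    \<and> lagrangian_submanifold (nondegeneracy_locus \<pi>) (symplectic_form \<pi>) {(x, p). p = 0}"
proof (intro exI[of _ "cotangent_field \<epsilon>"] conjI allI impI)
  let ?\<pi> = "cotangent_field \<epsilon> :: (real^'n::{finite,linorder}) \<times> (real^'n::{finite,linorder}) \<Rightarrow> _"
  note \<pi> = bivector_field_cotangent[of \<epsilon>] cotangent_brackets_cotangent_field[of \<epsilon>]
  show "bivector_field ?\<pi>" "cotangent_brackets \<epsilon> ?\<pi>" by (fact \<pi>)+
  show "\<pi>' = ?\<pi>" if "bivector_field \<pi>' \<and> cotangent_brackets \<epsilon> \<pi>'" for \<pi>'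
    using cotangent_brackets_unique[OF \<pi>] that by blast
  show "poisson_structure ?\<pi>" by (rule poisson_structure_cotangent[OF \<pi>])
  show "poisson_structure (standard_r_field \<epsilon> :: real^'n::{finite,linorder} \<Rightarrow> (real^'n::{finite,linorder}) bivec)"
    by (rule poisson_structure_standard_r)
  show "bracket (standard_r_field \<epsilon>) (\<lambda>y. y $ j) (\<lambda>y. y $ k) x = \<epsilon> * x $ j * x $ k"
    if "j < k" for j k :: 'n and x
    using that by (rule bracket_standard_r_less)
  show "poisson_map ?\<pi> (standard_r_field \<epsilon>) fst" by (rule poisson_map_fst)
  show "\<exists>W. open W \<and> UNIV \<times> {0} \<union> {0} \<times> UNIV \<subseteq> W \<and> (\<forall>z\<in>W. nondegenerate (?\<pi> z))"
    by (intro exI[of _ "nondegeneracy_locus ?\<pi>"] conjI open_nondegeneracy_locus[OF \<pi>(1)])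
      (auto simp: nondegeneracy_locus_def intro: nondegenerate_cotangent_field)
  show "lagrangian_submanifold (nondegeneracy_locus ?\<pi>) (symplectic_form ?\<pi>) {(x, p). p = 0}"
    by (rule lagrangian_zero_section)
qed

end
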